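(* Let $r$ be a fixed positive integer. For every $\varepsilon>0$ there exist constants $C=C(r,\varepsilon)>0$ and $p_0=p_0(r,\varepsilon)$ such that the following holds for every prime $p\ge p_0$. Let $\mathcal{M}\subseteq\mathbb{F}_p$ be an arbitrary set of cardinality $M\ge1$ and let $\mathcal{J}\subseteq\mathbb{F}_p^*$ be an interval of length $N$ with $1\le N\le p^{1-1/r}$. Then for arbitrary complex weights $\boldsymbol\alpha=\{\alpha_m\}_{m\in\mathcal{M}}$, $$\Bigl|\sum_{m\in\mathcal{M}}\sum_{n\in\mathcal{J}}\alpha_m\,\mathcal{K}_p(m,n)\Bigr|\le C\,\|\boldsymbol\alpha\|_\infty\,MN\,p^{1/2+\varepsilon}\left(\frac{p^{1/2}}{M^{7/(24r)}N}+\frac{p^{1/2-7(r-1)/(24r^2)}}{M^{7/(24r)}N^{1-7/(12r)}}\right).$$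
   Context: $\mathbf{e}_p(z)=\exp(2\pi i z/p)$, and the Kloosterman sum is $\mathcal{K}_p(m,n)=\sum_{x\in\mathbb{F}_p^*}\mathbf{e}_p(mx+nx^{-1})$, with $x^{-1}$ the inverse of $x$ in $\mathbb{F}_p^*$. $\mathbb{F}_p$ is identified with $\{0,1,\dots,p-1\}$; an interval in $\mathbb{F}_p$ of length $N$ is the set of residues modulo $p$ of $N$ consecutive integers $N_0+1,\dots,N_0+N$. $\|\boldsymbol\alpha\|_\infty=\max_m|\alpha_m|$. The paper's notation $f\ll p^{o(1)}g$ means: for every $\varepsilon>0$ there is a constant $C_\varepsilon$ with $|f|\le C_\varepsilon p^\varepsilon g$ for all sufficiently large $p$; this has been written out in the claim. *)

theory Defs
  imports "HOL-Analysis.Analysis" "HOL-Number_Theory.Number_Theory"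
begin

text \<open>
  Throughout, the field with \<open>p\<close> elements is identified with its set of least nonnegative
  residues, as integers.
\<close>

definition Fp :: "nat \<Rightarrow> int set" where
  "Fp p = {0..<int p}"

definition Fp_units :: "nat \<Rightarrow> int set" where
  "Fp_units p = Fp p - {0}"

definition e_p :: "nat \<Rightarrow> int \<Rightarrow> complex" where
  "e_p p z = exp (2 * of_real pi * \<i> * of_int z / of_nat p)"

definition kloosterman :: "nat \<Rightarrow> int \<Rightarrow> int \<Rightarrow> complex" where
  "kloosterman p m n =
     (\<Sum>x\<in>Fp_units p. e_p p (m * x + n * modular_inverse (int p) x))"

text \<open>
  Reduction modulo \<open>p\<close> allows an interval to wrap around past \<open>p - 1\<close>.  Its cardinality
  is \<open>N\<close> as long as \<open>N \<le> p\<close>.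
\<close>

definition Fp_interval :: "nat \<Rightarrow> nat \<Rightarrow> int set \<Rightarrow> bool" where
  "Fp_interval p N J \<longleftrightarrow>
     (\<exists>N0 :: int. J = (\<lambda>k. k mod int p) ` {N0 + 1..N0 + int N})"

text \<open>The maximum below is only meaningful for finite nonempty \<open>M\<close>.\<close>

definition sup_norm_on :: "int set \<Rightarrow> (int \<Rightarrow> complex) \<Rightarrow> real" where
  "sup_norm_on M \<alpha> = (MAX m\<in>M. cmod (\<alpha> m))"

end

theory Submission
  imports Defs
begin

text \<open>
  Opening the Kloosterman sums and replacing \<open>x\<close> by \<open>1/y\<close> turns the inner sum over \<open>n\<close> into
  \<open>\<Sum> F(y) e(m/y)\<close>, where \<open>F(y) = \<Sum>\<^bsub>n\<in>J\<^esub> e(n y)\<close> has size at most \<open>min N (p/\<bar>y\<bar>)\<close>.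
  By Hoelder's inequality it suffices to bound the \<open>2r\<close>-th moment over all \<open>m\<close>.  Such a moment is
  a positive form in the coefficients, so the phases of \<open>F\<close> may be dropped and \<open>\<bar>F\<bar>\<close> be
  replaced by any majorant.  A majorant of the interval \<open>[1, U]\<close> is the normalised number of ways
  to write \<open>u = y + a b\<close> with \<open>a \<le> A\<close>, \<open>b \<le> B\<close>, \<open>\<bar>y\<bar> \<le> U\<close>, and
  \<open>m/(y + a b) = (m/b)/(y/b + a)\<close>.  Few pairs \<open>(b, y)\<close> share the same ratio \<open>y/b\<close>, so the moment is
  controlled by that of \<open>\<Sum>\<^bsub>a\<^esub> e(l/(s + a))\<close> over all \<open>l\<close> and \<open>s\<close>.  The latter counts zeros of
  rational functions in \<open>s\<close> and is essentially diagonal as soon as \<open>A\<close> is about \<open>p\<^bsup>1/r\<^esup>\<close>.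
  This gives the saving \<open>M\<^bsup>-1/(2r)\<^esup>\<close>; interpolating with the trivial bound yields every smaller
  exponent, in particular \<open>7/(24r)\<close>.
\<close>

subsection \<open>Even moments of exponential sums modulo p\<close>

lemma finite_Fp [simp]: "finite (Fp p)" and card_Fp [simp]: "card (Fp p) = p"
  by (simp_all add: Fp_def)

lemma norm_e_p [simp]: "norm (e_p p z) = 1"
proof -
  have "e_p p z = exp (\<i> * of_real (2 * pi * real_of_int z / real p))"
    by (simp add: e_p_def mult_ac)
  thus ?thesis by (metis norm_exp_i_times)
qed

lemma cnj_e_p: "cnj (e_p p z) = e_p p (-z)"
  by (simp add: e_p_def exp_cnj)

lemma e_p_add: "e_p p (x + y) = e_p p x * e_p p y"
  by (simp add: e_p_def ring_distribs add_divide_distrib exp_add)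

lemma e_p_0 [simp]: "e_p p 0 = 1"
  by (simp add: e_p_def)

lemma e_p_sum: "e_p p (\<Sum>i\<in>I. f i) = (\<Prod>i\<in>I. e_p p (f i))"
  by (induction I rule: infinite_finite_induct) (auto simp: e_p_add)

lemma e_p_mult_nat: "e_p p (int k * z) = e_p p z ^ k"
  by (induction k) (simp_all add: ring_distribs e_p_add)

lemma e_p_eq_1_iff:
  assumes "p > 0"
  shows "e_p p z = 1 \<longleftrightarrow> int p dvd z"
proof -
  have "e_p p z = 1 \<longleftrightarrow> (\<exists>n::int. 2 * pi * real_of_int z / real p = real_of_int (2 * n) * pi)"
    unfolding e_p_def exp_eq_1 by (simp add: Re_divide_of_nat Im_divide_of_nat)
  also have "\<dots> \<longleftrightarrow> (\<exists>n::int. real_of_int z = real_of_int (int p * n))"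
    using assms by (simp add: field_simps)
  also have "\<dots> \<longleftrightarrow> int p dvd z"
    unfolding of_int_eq_iff by auto
  finally show ?thesis .
qed

lemma e_p_cong:
  assumes "p > 0" "[x = y] (mod int p)"
  shows "e_p p x = e_p p y"
proof -
  have "e_p p (x - y) = 1"
    using assms by (simp add: e_p_eq_1_iff cong_iff_dvd_diff)
  thus ?thesis
    using e_p_add[of p "x - y" y] by simp
qed

lemma sum_e_p:
  assumes "p > 0"
  shows "(\<Sum>x\<in>Fp p. e_p p (x * t)) = (if int p dvd t then of_nat p else 0)"
proof -
  have "(\<Sum>x\<in>Fp p. e_p p (x * t)) = (\<Sum>k<p. e_p p (int k * t))"
    unfolding Fp_def
    by (rule sum.reindex_bij_witness[of _ int nat]) auto
  also have "\<dots> = (\<Sum>k<p. e_p p t ^ k)"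
    by (simp add: e_p_mult_nat)
  also have "\<dots> = (if int p dvd t then of_nat p else 0)"
  proof (cases "int p dvd t")
    case True
    then show ?thesis using e_p_eq_1_iff[OF assms, of t] by simp
  next
    case False
    have "e_p p t ^ p = 1"
      using e_p_eq_1_iff[OF assms, of "int p * t"] by (simp flip: e_p_mult_nat)
    with False show ?thesis using e_p_eq_1_iff[OF assms, of t]
      by (simp add: sum_gp_strict)
  qed
  finally show ?thesis .
qed

text \<open>Expanding the square and summing over \<open>x\<close> first leaves only pairs with
  congruent phases, by orthogonality. The index type is arbitrary because tuples serve as indices
  next.\<close>

lemma parseval_Fp:
  fixes c :: "'a \<Rightarrow> complex" and g :: "'a \<Rightarrow> int"
  assumes "p > 0" "finite T"
  shows "of_real (\<Sum>x\<in>Fp p. (norm (\<Sum>t\<in>T. c t * e_p p (x * g t)))\<^sup>2) =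
         of_nat p * (\<Sum>(t, t')\<in>{(t, t')\<in>T \<times> T. [g t = g t'] (mod int p)}. c t * cnj (c t'))"
proof -
  have "of_real (\<Sum>x\<in>Fp p. (norm (\<Sum>t\<in>T. c t * e_p p (x * g t)))\<^sup>2) =
        (\<Sum>x\<in>Fp p. \<Sum>t\<in>T. \<Sum>t'\<in>T. c t * cnj (c t') * e_p p (x * (g t - g t')))"
    unfolding of_real_sum complex_norm_square sum_product cnj_sum
    by (intro sum.cong refl)
       (simp add: cnj_e_p mult_ac flip: e_p_add, simp add: algebra_simps)
  also have "\<dots> = (\<Sum>t\<in>T. \<Sum>x\<in>Fp p. \<Sum>t'\<in>T. c t * cnj (c t') * e_p p (x * (g t - g t')))"
    by (rule sum.swap)
  also have "\<dots> = (\<Sum>t\<in>T. \<Sum>t'\<in>T. c t * cnj (c t') * (\<Sum>x\<in>Fp p. e_p p (x * (g t - g t'))))"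
    by (intro sum.cong refl) (subst sum.swap, simp add: sum_distrib_left)
  also have "\<dots> = (\<Sum>(t, t')\<in>T \<times> T. c t * cnj (c t') * (if int p dvd g t - g t' then of_nat p else 0))"
    using assms by (simp add: sum_e_p sum.cartesian_product)
  also have "\<dots> = (\<Sum>(t, t')\<in>{(t, t')\<in>T \<times> T. [g t = g t'] (mod int p)}. of_nat p * (c t * cnj (c t')))"
    using assms
    by (intro sum.mono_neutral_cong_right) (auto simp: cong_iff_dvd_diff split: if_splits)
  finally show ?thesis
    by (simp add: sum_distrib_left case_prod_unfold)
qed

lemma power_sum_PiE:
  fixes f :: "'a \<Rightarrow> 'c :: comm_semiring_1"
  assumes "finite X"
  shows "(\<Sum>x\<in>X. f x) ^ r = (\<Sum>t\<in>PiE {..<r} (\<lambda>_. X). \<Prod>i<r. f (t i))"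
  using prod_sum_PiE[of "{..<r}" "\<lambda>_. X" "\<lambda>_. f"] assms by simp

text \<open>The \<open>r\<close>-th power of an exponential sum is an exponential sum over
  \<open>r\<close>-tuples, with coefficients multiplied and phases added, so the second-moment
  identity applies to it.\<close>

lemma even_moment_Fp:
  fixes c :: "'a \<Rightarrow> complex" and g :: "'a \<Rightarrow> int" and r :: nat
  assumes "p > 0" "finite X"
  defines "T \<equiv> PiE {..<r} (\<lambda>_. X)"
  shows "of_real (\<Sum>x\<in>Fp p. norm (\<Sum>t\<in>X. c t * e_p p (x * g t)) ^ (2 * r)) =
         of_nat p * (\<Sum>(t, t')\<in>{(t, t')\<in>T \<times> T. [(\<Sum>i<r. g (t i)) = (\<Sum>i<r. g (t' i))] (mod int p)}.
            (\<Prod>i<r. c (t i)) * cnj (\<Prod>i<r. c (t' i)))"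
proof -
  have fin: "finite T" unfolding T_def using assms by (intro finite_PiE) auto
  have "norm (\<Sum>t\<in>X. c t * e_p p (x * g t)) ^ (2 * r) =
        (norm (\<Sum>t\<in>T. (\<Prod>i<r. c (t i)) * e_p p (x * (\<Sum>i<r. g (t i)))))\<^sup>2" for x
    by (simp add: mult.commute[of 2] power_mult power_sum_PiE[OF assms(2)] prod.distrib
          sum_distrib_left e_p_sum T_def flip: norm_power)
  thus ?thesis
    by (simp only: parseval_Fp[OF assms(1) fin])
qed

text \<open>The solution set of the congruence depends on \<open>g\<close> alone and each solution
  enters with a product of coefficients. The triangle inequality therefore replaces \<open>c\<close>
  by \<open>d\<close>, and the identity is then read backwards.\<close>

lemma even_moment_Fp_mono:
  fixes c :: "'a \<Rightarrow> complex" and d :: "'a \<Rightarrow> real" and g :: "'a \<Rightarrow> int"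
  assumes "p > 0" "finite X" and le: "\<And>t. t \<in> X \<Longrightarrow> norm (c t) \<le> d t"
  shows "(\<Sum>x\<in>Fp p. norm (\<Sum>t\<in>X. c t * e_p p (x * g t)) ^ (2 * r)) \<le>
         (\<Sum>x\<in>Fp p. norm (\<Sum>t\<in>X. of_real (d t) * e_p p (x * g t)) ^ (2 * r))"
proof -
  define T where "T = PiE {..<r} (\<lambda>_. X)"
  define S where "S = {(t, t')\<in>T \<times> T. [(\<Sum>i<r. g (t i)) = (\<Sum>i<r. g (t' i))] (mod int p)}"
  have "norm (of_real (\<Sum>x\<in>Fp p. norm (\<Sum>t\<in>X. c t * e_p p (x * g t)) ^ (2 * r)) :: complex) \<le>
        real p * (\<Sum>(t, t')\<in>S. (\<Prod>i<r. d (t i)) * (\<Prod>i<r. d (t' i)))"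
    unfolding even_moment_Fp[OF assms(1,2)] norm_mult norm_of_nat T_def[symmetric] S_def[symmetric]
  proof (intro mult_left_mono order.trans[OF norm_sum] sum_mono)
    fix tt assume "tt \<in> S"
    then obtain t t' where "tt = (t, t')" "t \<in> T" "t' \<in> T"
      by (auto simp: S_def)
    have "norm (\<Prod>i<r. c (u i)) \<le> (\<Prod>i<r. d (u i))" if "u \<in> T" for u
      unfolding prod_norm[symmetric]
      using that by (intro prod_mono) (auto simp: T_def PiE_def Pi_def intro: le)
    note this[OF \<open>t \<in> T\<close>] this[OF \<open>t' \<in> T\<close>]
    hence "norm (\<Prod>i<r. c (t i)) * norm (\<Prod>i<r. c (t' i)) \<le> (\<Prod>i<r. d (t i)) * (\<Prod>i<r. d (t' i))"
      by (intro mult_mono) (auto intro: order.trans[OF norm_ge_zero])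
    thus "norm (case tt of (t, t') \<Rightarrow> (\<Prod>i<r. c (t i)) * cnj (\<Prod>i<r. c (t' i))) \<le>
          (case tt of (t, t') \<Rightarrow> (\<Prod>i<r. d (t i)) * (\<Prod>i<r. d (t' i)))"
      unfolding \<open>tt = (t, t')\<close> prod.case norm_mult complex_mod_cnj .
  qed auto
  also have "\<dots> = (\<Sum>x\<in>Fp p. norm (\<Sum>t\<in>X. of_real (d t) * e_p p (x * g t)) ^ (2 * r))"
  proof -
    have "of_real (real p * (\<Sum>(t, t')\<in>S. (\<Prod>i<r. d (t i)) * (\<Prod>i<r. d (t' i)))) =
       (of_real (\<Sum>x\<in>Fp p. norm (\<Sum>t\<in>X. of_real (d t) * e_p p (x * g t)) ^ (2 * r)) :: complex)"
      unfolding even_moment_Fp[OF assms(1,2)] T_def[symmetric] S_def[symmetric]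
      by (simp add: case_prod_unfold)
    thus ?thesis by (simp only: of_real_eq_iff)
  qed
  finally show ?thesis
    unfolding norm_of_real by (rule order.trans[OF abs_ge_self])
qed

text \<open>Jensen's inequality for an even power, after division by the total weight. It is applied
  with multiplicities, with the weights \<open>c U\<close> and with constant weights.\<close>

lemma power_mean_even:
  fixes w x :: "'a \<Rightarrow> real"
  assumes "finite I" and w: "\<And>i. i \<in> I \<Longrightarrow> w i \<ge> 0" and "r \<ge> 1"
  shows "(\<Sum>i\<in>I. w i * x i) ^ (2 * r) \<le> (\<Sum>i\<in>I. w i) ^ (2 * r - 1) * (\<Sum>i\<in>I. w i * x i ^ (2 * r))"
proof (cases "(\<Sum>i\<in>I. w i) = 0")
  case True
  hence "\<And>i. i \<in> I \<Longrightarrow> w i = 0"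
    using assms by (simp add: sum_nonneg_eq_0_iff)
  thus ?thesis using assms by (simp add: power_0_left)
next
  case False
  define W where "W = (\<Sum>i\<in>I. w i)"
  have W: "W > 0"
    using False w by (simp add: W_def less_le sum_nonneg)
  have "(\<Sum>i\<in>I. (w i / W) *\<^sub>R x i) ^ (2 * r) \<le> (\<Sum>i\<in>I. w i / W * x i ^ (2 * r))"
    using W w assms(1) False
    by (intro convex_on_sum[OF assms(1) _ convex_power_even[of "2 * r"]])
       (auto simp: W_def simp flip: sum_divide_distrib)
  hence "((\<Sum>i\<in>I. w i * x i) / W) ^ (2 * r) \<le> (\<Sum>i\<in>I. w i * x i ^ (2 * r)) / W"
    by (simp add: sum_divide_distrib)
  hence "(\<Sum>i\<in>I. w i * x i) ^ (2 * r) \<le> W ^ (2 * r) * ((\<Sum>i\<in>I. w i * x i ^ (2 * r)) / W)"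
    using W by (simp add: power_divide divide_simps mult_ac)
  also have "\<dots> = W ^ (2 * r - 1) * (\<Sum>i\<in>I. w i * x i ^ (2 * r))"
    using W \<open>r \<ge> 1\<close> by (simp add: power_diff)
  finally show ?thesis by (simp add: W_def)
qed

text \<open>Lagrange's bound, kept over the integers: synthetic division by a root lowers the
  degree. The point \<open>x1\<close> certifies that \<open>P\<close> does not vanish identically
  modulo \<open>p\<close>, and the same point works for the quotient.\<close>

lemma card_roots_mod_prime_le:
  fixes P :: "int poly"
  assumes "prime p" "degree P \<le> d" "\<not> int p dvd poly P x1"
  shows "card {x \<in> Fp p. int p dvd poly P x} \<le> d"
  using assms(2,3)
proof (induction d arbitrary: P)
  case 0
  then obtain c where "P = [:c:]"
    by (metis degree_eq_zeroE le_zero_eq)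
  with 0 have "{x \<in> Fp p. int p dvd poly P x} = {}" by auto
  then show ?case by simp
next
  case (Suc d)
  show ?case
  proof (cases "{x \<in> Fp p. int p dvd poly P x} = {}")
    case False
    then obtain x0 where x0: "x0 \<in> Fp p" "int p dvd poly P x0" by auto
    define Q where "Q = synthetic_div P x0"
    have P: "poly P x = (x - x0) * poly Q x + poly P x0" for x
    proof -
      have "poly (P + Polynomial.smult x0 Q) x = poly (pCons (poly P x0) Q) x"
        unfolding Q_def using synthetic_div_correct[of P x0] by simp
      thus ?thesis by (simp add: algebra_simps)
    qed
    have "\<not> int p dvd poly Q x1"
    proof
      assume "int p dvd poly Q x1"
      hence "int p dvd poly P x1"
        by (subst P) (intro dvd_add dvd_mult x0(2))
      with Suc.prems(2) show False by simp
    qed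
    moreover have "degree Q \<le> d"
      using Suc.prems(1) by (simp add: Q_def degree_synthetic_div)
    ultimately have "card {x \<in> Fp p. int p dvd poly Q x} \<le> d"
      by (intro Suc.IH)
    have "x = x0" if x: "x \<in> Fp p" "int p dvd poly P x" "\<not> int p dvd poly Q x" for x
    proof -
      have "int p dvd (x - x0) * poly Q x"
        using dvd_diff[OF x(2) x0(2)] P[of x] by simp
      hence "int p dvd x - x0"
        using x(3) assms(1) by (simp add: prime_dvd_mult_iff)
      thus ?thesis
        using x(1) x0(1) by (auto simp: Fp_def simp flip: mod_eq_dvd_iff)
    qed
    hence "card {x \<in> Fp p. int p dvd poly P x} \<le> card (insert x0 {x \<in> Fp p. int p dvd poly Q x})"
      by (intro card_mono) auto
    also have "\<dots> \<le> Suc (card {x \<in> Fp p. int p dvd poly Q x})"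
      by (simp add: card_insert_if)
    also have "\<dots> \<le> Suc d"
      using \<open>card {x \<in> Fp p. int p dvd poly Q x} \<le> d\<close> by simp
    finally show ?thesis .
  next
    case True
    thus ?thesis by (metis card.empty zero_le)
  qed
qed

subsection \<open>Collisions of shifted reciprocals\<close>

lemma coprime_int_prime:
  assumes "prime p" "\<not> int p dvd x"
  shows "coprime x (int p)"
  using assms by (metis coprime_commute prime_imp_coprime prime_int_nat_transfer prime_nat_int_transfer)

text \<open>Grouping equal shifts turns a collision into a linear relation between the reciprocals
  at distinct shifts, with multiplicities as coefficients.\<close>

lemma sum_comp_eq_sum_card_fibre:
  fixes f :: "'a \<Rightarrow> int" and r :: nat
  assumes "finite Y" "t ` {..<r} \<subseteq> Y"
  shows "(\<Sum>i<r. f (t i)) = (\<Sum>a\<in>Y. int (card {i \<in> {..<r}. t i = a}) * f a)"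
proof -
  have "(\<Sum>i<r. f (t i)) = (\<Sum>a\<in>Y. \<Sum>i | i \<in> {..<r} \<and> t i = a. f (t i))"
    using assms by (subst sum.group) auto
  also have "\<dots> = (\<Sum>a\<in>Y. \<Sum>i | i \<in> {..<r} \<and> t i = a. f a)"
    by (intro sum.cong) auto
  finally show ?thesis by simp
qed

text \<open>Values of \<open>s\<close> at which some denominator vanishes are left out, in
  accordance with the sums of \<open>shifted_reciprocal_sum\<close>.\<close>

definition reciprocal_collisions :: "nat \<Rightarrow> nat \<Rightarrow> (nat \<Rightarrow> int) \<Rightarrow> (nat \<Rightarrow> int) \<Rightarrow> int set" where
  "reciprocal_collisions p r t t' =
     {s \<in> Fp p. (\<forall>i<r. \<not> int p dvd s + t i \<and> \<not> int p dvd s + t' i) \<and>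
        [(\<Sum>i<r. modular_inverse (int p) (s + t i)) =
         (\<Sum>i<r. modular_inverse (int p) (s + t' i))] (mod int p)}"

text \<open>Clearing denominators gives a polynomial of degree at most \<open>2 * r\<close> that
  vanishes at every collision. At \<open>-a0\<close> only the term of \<open>a0\<close> survives. It
  is nonzero modulo \<open>p\<close>: its coefficient is nonzero and below \<open>p\<close> in
  absolute value, and distinct elements of \<open>[1, A]\<close> stay distinct modulo
  \<open>p\<close>.\<close>

lemma card_reciprocal_collisions_le:
  fixes t t' :: "nat \<Rightarrow> int"
  assumes p: "prime p" and "A \<le> p" "r < p"
    and t: "t \<in> PiE {..<r} (\<lambda>_. {1..int A})" and t': "t' \<in> PiE {..<r} (\<lambda>_. {1..int A})"
    and ne: "card {i \<in> {..<r}. t i = a0} \<noteq> card {i \<in> {..<r}. t' i = a0}"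
  shows "card (reciprocal_collisions p r t t') \<le> 2 * r"
proof -
  define Y where "Y = t ` {..<r} \<union> t' ` {..<r}"
  define c where "c a = int (card {i \<in> {..<r}. t i = a}) - int (card {i \<in> {..<r}. t' i = a})" for a
  \<comment> \<open>The numerator of \<open>\<Sum> c a / (x + a)\<close>; it does not vanish at \<open>- a0\<close>.\<close>
  define P where "P = (\<Sum>a\<in>Y. [:c a:] * (\<Prod>b\<in>Y-{a}. [:b, 1:]))"
  have finY: "finite Y" by (simp add: Y_def)
  have Ysub: "Y \<subseteq> {1..int A}" using t t' by (auto simp: Y_def)
  have cardY: "card Y \<le> 2 * r"
  proof -
    have "card Y \<le> card (t ` {..<r}) + card (t' ` {..<r})"
      unfolding Y_def by (rule card_Un_le)
    also have "\<dots> \<le> r + r"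
      by (intro add_mono) (metis card_image_le card_lessThan finite_lessThan)+
    finally show ?thesis by simp
  qed
  have poly_P: "poly P x = (\<Sum>a\<in>Y. c a * (\<Prod>b\<in>Y-{a}. b + x))" for x
    by (simp add: P_def poly_sum poly_prod)
  have "degree P \<le> 2 * r"
    unfolding P_def
  proof (rule degree_sum_le[OF finY])
    fix a assume "a \<in> Y"
    have "degree ([:c a:] * (\<Prod>b\<in>Y-{a}. [:b, 1:])) \<le> degree [:c a:] + degree (\<Prod>b\<in>Y-{a}. [:b, 1:])"
      by (rule degree_mult_le)
    also have "\<dots> \<le> 0 + (\<Sum>b\<in>Y-{a}. degree [:b, 1:])"
      using finY by (intro add_mono order.trans[OF degree_prod_sum_le]) (auto simp: o_def)
    also have "\<dots> \<le> 2 * r"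
      using cardY card_mono[OF finY, of "Y - {a}"] by auto
    finally show "degree ([:c a:] * (\<Prod>b\<in>Y-{a}. [:b, 1:])) \<le> 2 * r" .
  qed
  moreover have "\<not> int p dvd poly P (-a0)"
  proof -
    have a0: "a0 \<in> Y"
    proof (rule ccontr)
      assume "a0 \<notin> Y"
      hence "{i \<in> {..<r}. t i = a0} = {}" "{i \<in> {..<r}. t' i = a0} = {}"
        by (auto simp: Y_def)
      with ne show False by metis
    qed
    have "(\<Prod>b\<in>Y-{a}. b + - a0) = 0" if "a \<in> Y - {a0}" for a
      using that finY a0 by (intro prod_zero) auto
    hence "poly P (-a0) = c a0 * (\<Prod>b\<in>Y-{a0}. b + - a0)"
      unfolding poly_P using finY a0
      by (subst sum.remove[of Y a0]) (auto intro!: sum.neutral)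
    moreover have "\<not> int p dvd c a0"
    proof -
      have le: "card {i \<in> {..<r}. u i = a0} \<le> r" for u :: "nat \<Rightarrow> int"
        using card_mono[of "{..<r}" "{i \<in> {..<r}. u i = a0}"] by auto
      have "c a0 \<noteq> 0" using ne by (simp add: c_def)
      moreover have "\<bar>c a0\<bar> < int p"
        using le[of t] le[of t'] \<open>r < p\<close> unfolding c_def by linarith
      ultimately show ?thesis
        using zdvd_not_zless[of "\<bar>c a0\<bar>" "int p"] by simp
    qed
    moreover have "\<not> int p dvd b + - a0" if "b \<in> Y - {a0}" for b
    proof -
      have "b \<in> {1..int A}" "a0 \<in> {1..int A}" "b \<noteq> a0"
        using that a0 Ysub by auto
      hence "b - a0 \<noteq> 0" "\<bar>b - a0\<bar> < int p" using \<open>A \<le> p\<close> by auto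
      thus ?thesis
        using zdvd_not_zless[of "\<bar>b - a0\<bar>" "int p"] by simp
    qed
    ultimately show ?thesis
      using p finY by (simp add: prime_dvd_mult_iff prime_dvd_prod_iff)
  qed
  ultimately have "card {x \<in> Fp p. int p dvd poly P x} \<le> 2 * r"
    using p by (intro card_roots_mod_prime_le)
  moreover have "int p dvd poly P s" if s: "s \<in> reciprocal_collisions p r t t'" for s
  proof -
    define v where "v a = modular_inverse (int p) (s + a)" for a
    have nz: "\<not> int p dvd s + a" if "a \<in> Y" for a
      using s that by (auto simp: Y_def reciprocal_collisions_def)
    have eq: "(\<Sum>i<r. v (t i)) - (\<Sum>i<r. v (t' i)) = (\<Sum>a\<in>Y. c a * v a)"
      by (subst (1 2) sum_comp_eq_sum_card_fibre[OF finY])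
         (auto simp: Y_def c_def left_diff_distrib sum_subtractf)
    have "int p dvd (\<Sum>a\<in>Y. c a * v a)"
      using s unfolding eq[symmetric] by (auto simp: reciprocal_collisions_def v_def cong_iff_dvd_diff)
    hence "[0 = (\<Sum>a\<in>Y. c a * v a) * (\<Prod>b\<in>Y. b + s)] (mod int p)"
      by (simp add: cong_0_iff cong_sym_eq[of 0])
    also have "(\<Sum>a\<in>Y. c a * v a) * (\<Prod>b\<in>Y. b + s) =
               (\<Sum>a\<in>Y. c a * ((s + a) * v a) * (\<Prod>b\<in>Y-{a}. b + s))"
      unfolding sum_distrib_right
      by (intro sum.cong refl) (subst prod.remove[OF finY], auto simp: algebra_simps)
    also have "[\<dots> = (\<Sum>a\<in>Y. c a * 1 * (\<Prod>b\<in>Y-{a}. b + s))] (mod int p)"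
      unfolding v_def using p nz
      by (intro cong_sum cong_mult cong_refl cong_modular_inverse1 coprime_int_prime) auto
    finally show ?thesis
      by (simp add: poly_P cong_sym_eq[of 0] cong_0_iff)
  qed
  hence "card (reciprocal_collisions p r t t') \<le> card {x \<in> Fp p. int p dvd poly P x}"
    by (intro card_mono) (auto simp: reciprocal_collisions_def)
  ultimately show ?thesis by linarith
qed

text \<open>Terms whose denominator vanishes modulo \<open>p\<close> are skipped. The norm is built
  in because only the size of the sum matters later.\<close>

definition shifted_reciprocal_sum :: "nat \<Rightarrow> nat \<Rightarrow> int \<Rightarrow> int \<Rightarrow> real" where
  "shifted_reciprocal_sum p A l s =
     norm (\<Sum>a | a \<in> {1..int A} \<and> \<not> int p dvd s + a. e_p p (l * modular_inverse (int p) (s + a)))"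

text \<open>Equal fibre sizes force every value of \<open>t'\<close> to occur among the at most
  \<open>r\<close> values of \<open>t\<close>. This leaves at most \<open>r ^ r\<close> choices of
  \<open>t'\<close> for each of the \<open>A ^ r\<close> tuples \<open>t\<close>.\<close>

lemma card_equal_fibres_le:
  fixes A r :: nat
  defines "T \<equiv> PiE {..<r} (\<lambda>_. {1..int A})"
  shows "card {(t, t') \<in> T \<times> T. \<forall>a. card {i \<in> {..<r}. t i = a} = card {i \<in> {..<r}. t' i = a}}
           \<le> A ^ r * r ^ r" (is "card ?D \<le> _")
proof -
  have fin: "finite T" unfolding T_def by (intro finite_PiE) auto
  have "?D \<subseteq> Sigma T (\<lambda>t. PiE {..<r} (\<lambda>_. t ` {..<r}))"
  proof
    fix tt assume "tt \<in> ?D"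
    then obtain t t' where tt: "tt = (t, t')" "t \<in> T" "t' \<in> T"
      and eq: "\<And>a. card {i \<in> {..<r}. t i = a} = card {i \<in> {..<r}. t' i = a}"
      by auto
    have "t' i \<in> t ` {..<r}" if "i < r" for i
    proof -
      have "card {j \<in> {..<r}. t' j = t' i} \<noteq> 0"
        using that by (subst card_0_eq) auto
      hence "{j \<in> {..<r}. t j = t' i} \<noteq> {}"
        by (metis card.empty eq)
      thus ?thesis by force
    qed
    moreover have "t' i = undefined" if "i \<notin> {..<r}" for i
      using tt(3) that unfolding T_def by (rule PiE_arb)
    ultimately show "tt \<in> Sigma T (\<lambda>t. PiE {..<r} (\<lambda>_. t ` {..<r}))"
      using tt by (auto simp: PiE_iff extensional_def)
  qed
  hence "card ?D \<le> card (Sigma T (\<lambda>t. PiE {..<r} (\<lambda>_. t ` {..<r})))"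
    using fin by (intro card_mono finite_SigmaI finite_PiE) auto
  also have "\<dots> = (\<Sum>t\<in>T. card (t ` {..<r}) ^ r)"
    using fin by (subst card_SigmaI) (auto simp: card_PiE intro: finite_PiE)
  also have "\<dots> \<le> (\<Sum>t\<in>T. r ^ r)"
    by (intro sum_mono power_mono) (metis card_image_le card_lessThan finite_lessThan, simp)
  also have "\<dots> = A ^ r * r ^ r"
    by (simp add: T_def card_PiE)
  finally show ?thesis .
qed

text \<open>Orthogonality in \<open>l\<close> reduces the left side to \<open>p\<close> times the
  number of collisions \<open>(s, t, t')\<close>. Pairs that are rearrangements of each other
  collide for at most \<open>p\<close> values of \<open>s\<close>, all others for at most
  \<open>2 * r\<close>.\<close>

lemma shifted_reciprocal_sum_moment:
  assumes p: "prime p" and "A \<le> p" "r < p"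
  shows "(\<Sum>s\<in>Fp p. \<Sum>l\<in>Fp p. shifted_reciprocal_sum p A l s ^ (2 * r)) \<le>
           real p * (real p * real (r ^ r) * real A ^ r + 2 * real r * real A ^ (2 * r))"
proof -
  define T where "T = PiE {..<r} (\<lambda>_. {1..int A})"
  define D where "D = {(t, t') \<in> T \<times> T. \<forall>a. card {i \<in> {..<r}. t i = a} = card {i \<in> {..<r}. t' i = a}}"
  have fin: "finite T" unfolding T_def by (intro finite_PiE) auto
  have p0: "p > 0" using p prime_gt_0_nat by blast
  define R where "R tt = reciprocal_collisions p r (fst tt) (snd tt)" for tt
  have R_sub: "R tt \<subseteq> Fp p" for tt by (auto simp: R_def reciprocal_collisions_def)
  \<comment> \<open>The tuples avoiding poles depend on \<open>s\<close>. Moving the pole condition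
    into \<open>R tt\<close> makes the index set \<open>T \<times> T\<close> independent of
    \<open>s\<close>, so that the sums can be interchanged.\<close>
  have moment: "(\<Sum>l\<in>Fp p. shifted_reciprocal_sum p A l s ^ (2 * r)) \<le>
          real p * (\<Sum>tt\<in>T \<times> T. if s \<in> R tt then 1 else 0)" if s: "s \<in> Fp p" for s
  proof -
    define X where "X = {a. a \<in> {1..int A} \<and> \<not> int p dvd s + a}"
    define TX where "TX = PiE {..<r} (\<lambda>_. X)"
    define S where "S = {(t, t')\<in>TX \<times> TX. [(\<Sum>i<r. modular_inverse (int p) (s + t i)) =
                             (\<Sum>i<r. modular_inverse (int p) (s + t' i))] (mod int p)}"
    have finX: "finite X" by (rule finite_subset[of _ "{1..int A}"]) (auto simp: X_def)
    have "of_real (\<Sum>l\<in>Fp p. shifted_reciprocal_sum p A l s ^ (2 * r)) =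
          (of_real (real p * real (card S)) :: complex)"
      unfolding shifted_reciprocal_sum_def X_def[symmetric]
      using even_moment_Fp[OF p0 finX, where r = r and c = "\<lambda>_. 1" and
              g = "\<lambda>a. modular_inverse (int p) (s + a)", folded TX_def, folded S_def]
      by simp
    hence "(\<Sum>l\<in>Fp p. shifted_reciprocal_sum p A l s ^ (2 * r)) = real p * real (card S)"
      by (simp only: of_real_eq_iff)
    also have "card S \<le> card {tt \<in> T \<times> T. s \<in> R tt}"
    proof (intro card_mono)
      have "TX \<subseteq> T" unfolding TX_def T_def by (intro PiE_mono) (auto simp: X_def)
      moreover have "\<not> int p dvd s + t i" if "t \<in> TX" "i < r" for t i
        using that by (auto simp: TX_def X_def PiE_iff)
      ultimately show "S \<subseteq> {tt \<in> T \<times> T. s \<in> R tt}"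
        using s by (auto simp: S_def R_def reciprocal_collisions_def)
    qed (use fin in auto)
    also have "real (card {tt \<in> T \<times> T. s \<in> R tt}) = (\<Sum>tt\<in>T \<times> T. if s \<in> R tt then 1 else 0)"
      using fin by (simp add: sum.If_cases Int_def)
    finally show ?thesis by (simp add: mult_left_mono)
  qed
  have "(\<Sum>s\<in>Fp p. \<Sum>l\<in>Fp p. shifted_reciprocal_sum p A l s ^ (2 * r)) \<le>
        (\<Sum>s\<in>Fp p. real p * (\<Sum>tt\<in>T \<times> T. if s \<in> R tt then 1 else 0))"
    by (intro sum_mono moment)
  also have "\<dots> = real p * (\<Sum>tt\<in>T \<times> T. \<Sum>s\<in>Fp p. if s \<in> R tt then 1 else 0)"
    by (subst sum.swap) (simp add: sum_distrib_left)
  also have "\<dots> = real p * (\<Sum>tt\<in>T \<times> T. real (card (R tt)))"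
    using R_sub by (simp add: sum.If_cases Int_absorb1)
  \<comment> \<open>The term \<open>2 * r\<close> is granted to every pair, on the diagonal
    \<open>D\<close> as well, to keep the summation uniform.\<close>
  also have "\<dots> \<le> real p * (\<Sum>tt\<in>T \<times> T. (if tt \<in> D then real p else 0) + 2 * real r)"
  proof (intro mult_left_mono sum_mono)
    fix tt assume tt: "tt \<in> T \<times> T"
    show "real (card (R tt)) \<le> (if tt \<in> D then real p else 0) + 2 * real r"
    proof (cases "tt \<in> D")
      case True
      have "card (R tt) \<le> card (Fp p)" by (intro card_mono R_sub) auto
      thus ?thesis using True by simp
    next
      case False
      obtain t t' where [simp]: "tt = (t, t')" by force
      from False tt obtain a where "card {i \<in> {..<r}. t i = a} \<noteq> card {i \<in> {..<r}. t' i = a}"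
        unfolding D_def by auto
      hence "card (R tt) \<le> 2 * r"
        using card_reciprocal_collisions_le[OF assms, of t t' a] tt by (simp add: R_def T_def)
      thus ?thesis using False by simp
    qed
  qed simp
  also have "(\<Sum>tt\<in>T \<times> T. (if tt \<in> D then real p else 0) + 2 * real r) =
              real (card D) * real p + 2 * real r * real A ^ (2 * r)"
  proof -
    have "D \<subseteq> T \<times> T" by (auto simp: D_def)
    moreover have "real (card (T \<times> T)) = real A ^ (2 * r)"
      by (simp add: card_cartesian_product T_def card_PiE mult_2 power_add)
    ultimately show ?thesis
      using fin by (simp add: sum.distrib sum.If_cases Int_absorb1 mult_ac)
  qed
  also have "real (card D) * real p \<le> real (A ^ r * r ^ r) * real p"
    using card_equal_fibres_le[of r A]
    by (intro mult_right_mono of_nat_mono) (simp_all add: D_def T_def)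
  finally show ?thesis by (simp add: mult_ac mult_left_mono)
qed

subsection \<open>Equal ratios of small integers\<close>

text \<open>For fixed \<open>c\<close> there are \<open>c\<close> values \<open>c' \<le> c\<close>,
  contributing \<open>1 / c\<close> together. The other half is symmetric, and counting the diagonal
  twice does no harm.\<close>

lemma sum_inverse_max_square_le:
  "(\<Sum>(c, c')\<in>{1..B} \<times> {1..B}. 1 / real (max c c') ^ 2) \<le> 2 * harm B"
proof -
  have *: "(\<Sum>c\<in>{1..B}. \<Sum>c'\<in>{1..B}. if c' \<le> c then 1 / real c ^ 2 else 0) = harm B"
    unfolding harm_def
  proof (intro sum.cong refl)
    fix c assume c: "c \<in> {1..B}"
    have "(\<Sum>c'\<in>{1..B}. if c' \<le> c then 1 / real c ^ 2 else 0) = (\<Sum>c'\<in>{1..c}. 1 / real c ^ 2)"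
      using c by (intro sum.mono_neutral_cong_right) auto
    thus "(\<Sum>c'\<in>{1..B}. if c' \<le> c then 1 / real c ^ 2 else 0) = inverse (real c)"
      by (simp add: field_simps power2_eq_square)
  qed
  have "(\<Sum>(c, c')\<in>{1..B} \<times> {1..B}. 1 / real (max c c') ^ 2) =
        (\<Sum>c\<in>{1..B}. \<Sum>c'\<in>{1..B}. 1 / real (max c c') ^ 2)"
    by (simp add: sum.cartesian_product)
  also have "\<dots> \<le> (\<Sum>c\<in>{1..B}. \<Sum>c'\<in>{1..B}. (if c' \<le> c then 1 / real c ^ 2 else 0) +
                          (if c \<le> c' then 1 / real c' ^ 2 else 0))"
    by (intro sum_mono) (auto simp: max_def)
  also have "\<dots> = harm B + (\<Sum>c\<in>{1..B}. \<Sum>c'\<in>{1..B}. if c \<le> c' then 1 / real c' ^ 2 else 0)"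
    by (simp only: sum.distrib *)
  also have "(\<Sum>c\<in>{1..B}. \<Sum>c'\<in>{1..B}. if c \<le> c' then 1 / real c' ^ 2 else 0) = harm B"
    by (subst sum.swap) (rule *)
  finally show ?thesis by simp
qed

text \<open>A solution is \<open>(b, y, b', y') = (g c, k c, g c', k c')\<close> with \<open>g = gcd b b'\<close>.\<close>

lemma card_equal_ratios_le:
  fixes B U :: nat
  assumes "B \<le> U"
  defines "X \<equiv> {1..int B} \<times> {-int U..int U}"
  shows "real (card {(x, x') \<in> X \<times> X. snd x * fst x' = snd x' * fst x}) \<le> 6 * real U * real B * harm B"
    (is "real (card ?S) \<le> _")
proof -
  \<comment> \<open>\<open>I\<close> holds the ranges of \<open>g\<close> and \<open>k\<close> for
    given \<open>c\<close> and \<open>c'\<close>. Pairs that are not coprime are included too;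
    overcounting is harmless for an upper bound.\<close>
  define I where "I = (\<lambda>(c, c'). {1..B div max c c'} \<times> {-int (U div max c c')..int (U div max c c')})"
  define f where "f = (\<lambda>((c, c'), (g, k)). ((int (g * c), k * int c), (int (g * c'), k * int c')))"
  have "?S \<subseteq> f ` (SIGMA cc:{1..B} \<times> {1..B}. I cc)"
  proof
    fix z assume "z \<in> ?S"
    then obtain b y b' y' where z: "z = ((int b, y), (int b', y'))"
      and b: "b \<in> {1..B}" "b' \<in> {1..B}" and y: "\<bar>y\<bar> \<le> int U" "\<bar>y'\<bar> \<le> int U"
      and eq: "y * int b' = y' * int b"
    proof -
      assume *: "\<And>b y b' y'. \<lbrakk>z = ((int b, y), (int b', y')); b \<in> {1..B}; b' \<in> {1..B};
                  \<bar>y\<bar> \<le> int U; \<bar>y'\<bar> \<le> int U; y * int b' = y' * int b\<rbrakk> \<Longrightarrow> thesis"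
      obtain b y b' y' where "z = ((b, y), (b', y'))" by (metis surj_pair)
      with \<open>z \<in> ?S\<close> show thesis
        by (intro *[of "nat b" y "nat b'" y']) (auto simp: X_def)
    qed
    define g where "g = gcd b b'"
    have g: "g > 0" using b by (simp add: g_def)
    have "gcd b b' \<noteq> 0" using g by (simp add: g_def)
    from gcd_coprime_exists[OF this] obtain c c' where c: "b = g * c" "b' = g * c'" "coprime c c'"
      unfolding g_def[symmetric] by (metis mult.commute)
    have pos: "c > 0" "c' > 0" using b c by (auto intro!: Nat.gr0I)
    have eq': "y * int c' = y' * int c"
      using eq g by (simp add: c)
    hence "int c dvd y * int c'" by simp
    hence "int c dvd y"
      using c(3) by (simp add: coprime_dvd_mult_left_iff)
    then obtain k where k: "y = k * int c" by (metis dvdE mult.commute)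
    with eq' pos have k': "y' = k * int c'" by simp
    have "g * max c c' \<le> B"
      using b by (auto simp: c max_def)
    hence "g \<le> B div max c c'"
      using pos by (simp add: less_eq_div_iff_mult_less_eq)
    moreover have "nat \<bar>k\<bar> * max c c' \<le> U"
    proof -
      have "\<bar>k\<bar> * int (max c c') \<le> int U"
        using y by (auto simp: k k' abs_mult max_def)
      thus ?thesis by (metis int_nat_eq abs_ge_zero of_nat_le_iff of_nat_mult)
    qed
    hence "nat \<bar>k\<bar> \<le> U div max c c'"
      using pos by (simp add: less_eq_div_iff_mult_less_eq)
    hence "\<bar>k\<bar> \<le> int (U div max c c')" by linarith
    moreover have "c \<le> B" "c' \<le> B"
      using b order.trans[of c "g * c" B] order.trans[of c' "g * c'" B] g by (auto simp: c)
    ultimately have "((c, c'), (g, k)) \<in> (SIGMA cc:{1..B} \<times> {1..B}. I cc)"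
      using g pos by (auto simp: I_def)
    moreover have "z = f ((c, c'), (g, k))"
      by (simp add: f_def z c k k')
    ultimately show "z \<in> f ` (SIGMA cc:{1..B} \<times> {1..B}. I cc)" by blast
  qed
  hence "card ?S \<le> card (SIGMA cc:{1..B} \<times> {1..B}. I cc)"
    by (intro surj_card_le) (auto simp: I_def)
  also have "\<dots> = (\<Sum>cc\<in>{1..B} \<times> {1..B}. card (I cc))"
    by (subst card_SigmaI) (auto simp: I_def)
  finally have "real (card ?S) \<le> (\<Sum>cc\<in>{1..B} \<times> {1..B}. real (card (I cc)))"
    by (simp flip: of_nat_sum)
  also have "\<dots> \<le> (\<Sum>(c, c')\<in>{1..B} \<times> {1..B}. 3 * real U * real B * (1 / real (max c c') ^ 2))"
  proof (intro sum_mono)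
    fix cc assume "cc \<in> {1..B} \<times> {1..B}"
    then obtain c c' where cc: "cc = (c, c')" and c: "c \<in> {1..B}" "c' \<in> {1..B}" by auto
    define m where "m = max c c'"
    have m: "m > 0" "m \<le> U" using c assms(1) by (auto simp: m_def)
    \<comment> \<open>Since \<open>m \<le> B \<le> U\<close>, the quotient is at least 1, and
      \<open>2 * (U div m) + 1\<close> is at most \<open>3 * (U div m)\<close>.\<close>
    have 1: "U div m \<ge> 1" using m by (simp add: less_eq_div_iff_mult_less_eq)
    have "card (I cc) = (B div m) * (2 * (U div m) + 1)"
    proof -
      have "card {-int (U div m)..int (U div m)} = 2 * (U div m) + 1"
        by (simp add: nat_eq_iff)
      thus ?thesis by (simp only: I_def cc prod.case m_def card_cartesian_product card_atLeastAtMost) simp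
    qed
    also have "real \<dots> \<le> real (B div m) * (3 * real (U div m))"
      unfolding of_nat_mult using 1 by (intro mult_left_mono) auto
    also have "\<dots> \<le> (real B / real m) * (3 * (real U / real m))"
      by (intro mult_mono mult_left_mono of_nat_div_le_of_nat) auto
    also have "\<dots> = 3 * real U * real B * (1 / real m ^ 2)"
      by (simp add: power2_eq_square)
    finally show "real (card (I cc)) \<le> (case cc of (c, c') \<Rightarrow> 3 * real U * real B * (1 / real (max c c') ^ 2))"
      by (simp add: cc m_def)
  qed
  also have "\<dots> = 3 * real U * real B * (\<Sum>(c, c')\<in>{1..B} \<times> {1..B}. 1 / real (max c c') ^ 2)"
    by (simp add: sum_distrib_left case_prod_unfold)
  also have "\<dots> \<le> 3 * real U * real B * (2 * harm B)"
    by (intro mult_left_mono sum_inverse_max_square_le) auto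
  finally show ?thesis by simp
qed

section \<open>Rescaling of residues and progressions\<close>

lemma modular_inverse_cong_mult:
  assumes p: "prime p" and x: "[x = b * z] (mod int p)" and "\<not> int p dvd b" "\<not> int p dvd z"
  shows "[modular_inverse (int p) x = modular_inverse (int p) b * modular_inverse (int p) z] (mod int p)"
proof -
  have "[x * (modular_inverse (int p) b * modular_inverse (int p) z) =
         (b * z) * (modular_inverse (int p) b * modular_inverse (int p) z)] (mod int p)"
    by (intro cong_mult x cong_refl)
  also have "(b * z) * (modular_inverse (int p) b * modular_inverse (int p) z) =
        (b * modular_inverse (int p) b) * (z * modular_inverse (int p) z)"
    by (simp add: mult_ac)
  also have "[\<dots> = 1 * 1] (mod int p)"
    using assms by (intro cong_mult cong_modular_inverse1 coprime_int_prime) auto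
  finally have "[x * (modular_inverse (int p) b * modular_inverse (int p) z mod int p) = 1] (mod int p)"
    by (simp add: cong_def mod_mult_right_eq)
  hence "modular_inverse (int p) x = modular_inverse (int p) b * modular_inverse (int p) z mod int p"
    using p by (intro modular_inverse_int_eqI) (auto simp: prime_gt_0_nat)
  thus ?thesis by (simp add: cong_def)
qed

text \<open>Multiplication by a unit permutes the residues. This removes the factor
  \<open>1/b\<close> from a moment over all \<open>m\<close>.\<close>

lemma sum_Fp_mult:
  fixes f :: "int \<Rightarrow> 'b :: comm_monoid_add"
  assumes p: "prime p" and k: "\<not> int p dvd k"
    and f: "\<And>x y. [x = y] (mod int p) \<Longrightarrow> f x = f y"
  shows "(\<Sum>x\<in>Fp p. f (x * k)) = (\<Sum>x\<in>Fp p. f x)"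
proof -
  have p0: "p > 0" using p prime_gt_0_nat by blast
  have "inj_on (\<lambda>x. x * k mod int p) (Fp p)"
  proof (rule inj_onI)
    fix x y assume xy: "x \<in> Fp p" "y \<in> Fp p" "x * k mod int p = y * k mod int p"
    hence "[x = y] (mod int p)"
      using cong_mult_rcancel[OF coprime_int_prime[OF p k], of x y] by (simp add: cong_def)
    thus "x = y" using xy(1,2) by (auto simp: Fp_def cong_def)
  qed
  moreover have "(\<lambda>x. x * k mod int p) ` Fp p \<subseteq> Fp p"
    using p0 by (auto simp: Fp_def)
  ultimately have "bij_betw (\<lambda>x. x * k mod int p) (Fp p) (Fp p)"
    by (simp add: bij_betw_def endo_inj_surj)
  from sum.reindex_bij_betw[OF this, of f] show ?thesis
    by (simp add: f[of "_ mod int p"] cong_def)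
qed

lemma shifted_reciprocal_sum_cong:
  assumes "p > 0" "[l = l'] (mod int p)"
  shows "shifted_reciprocal_sum p A l s = shifted_reciprocal_sum p A l' s"
  unfolding shifted_reciprocal_sum_def
  by (intro arg_cong[of _ _ norm] sum.cong refl e_p_cong cong_mult assms cong_refl)

text \<open>With \<open>s = y / b\<close> one has \<open>y + a * b = b * (s + a)\<close> modulo
  \<open>p\<close>, so \<open>1/b\<close> moves into the multiplier and the poles correspond. The
  pair \<open>(b, y)\<close> then matters only through \<open>m / b\<close> and the ratio
  \<open>y / b\<close>.\<close>

lemma norm_sum_progression_eq:
  assumes p: "prime p" and b: "\<not> int p dvd b"
  shows "norm (\<Sum>a | a \<in> {1..int A} \<and> \<not> int p dvd y + a * b. e_p p (m * modular_inverse (int p) (y + a * b))) =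
         shifted_reciprocal_sum p A (m * modular_inverse (int p) b) (y * modular_inverse (int p) b mod int p)"
proof -
  define s where "s = y * modular_inverse (int p) b mod int p"
  have p0: "p > 0" using p prime_gt_0_nat by blast
  have cong: "[y + a * b = b * (s + a)] (mod int p)" for a
  proof -
    have "[b * s = y * (b * modular_inverse (int p) b)] (mod int p)"
      by (simp add: s_def cong_def mod_mult_right_eq mult_ac)
    also have "[y * (b * modular_inverse (int p) b) = y * 1] (mod int p)"
      using p b by (intro cong_mult cong_refl cong_modular_inverse1 coprime_int_prime)
    finally have "[b * s + b * a = y * 1 + b * a] (mod int p)"
      by (intro cong_add cong_refl)
    thus ?thesis by (simp add: cong_sym_eq algebra_simps)
  qed
  have dvd: "int p dvd y + a * b \<longleftrightarrow> int p dvd s + a" for a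
    using cong_dvd_iff[OF cong[of a]] p b by (simp add: prime_dvd_mult_iff)
  have "(\<Sum>a | a \<in> {1..int A} \<and> \<not> int p dvd y + a * b. e_p p (m * modular_inverse (int p) (y + a * b))) =
        (\<Sum>a | a \<in> {1..int A} \<and> \<not> int p dvd s + a.
            e_p p ((m * modular_inverse (int p) b) * modular_inverse (int p) (s + a)))"
    unfolding dvd mult.assoc using p p0 b
    by (intro sum.cong refl e_p_cong cong_mult cong_refl modular_inverse_cong_mult cong) auto
  thus ?thesis by (simp add: shifted_reciprocal_sum_def s_def)
qed

subsection \<open>Moments over an initial interval\<close>

text \<open>The condition \<open>A * B \<le> U\<close> keeps \<open>y = u - a * b\<close> inside
  \<open>[-U, U]\<close>, so every \<open>u\<close> has exactly \<open>A * B\<close>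
  representations. The condition \<open>2 * U * B < p\<close> turns a congruence of ratios
  \<open>y / b\<close> into an equality, which \<open>card_equal_ratios_le\<close> counts.\<close>

lemma initial_interval_moment:
  fixes \<gamma> :: "int \<Rightarrow> complex"
  assumes p: "prime p" and r: "1 \<le> r" "r < p" and "A \<le> p" "1 \<le> B" "B \<le> U"
    and AB: "A * B \<le> U" and UB: "2 * U * B < p"
    and \<gamma>: "\<And>u. u \<in> {1..int U} \<Longrightarrow> norm (\<gamma> u) \<le> 1"
  shows "(real A * real B) ^ (2 * r) *
           (\<Sum>m\<in>Fp p. norm (\<Sum>u\<in>{1..int U}. \<gamma> u * e_p p (m * modular_inverse (int p) u)) ^ (2 * r))
         \<le> (6 * real U * real B * harm B) ^ (2 * r - 1) *
           (real p * (real p * real (r ^ r) * real A ^ r + 2 * real r * real A ^ (2 * r)))"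
proof -
  have p0: "p > 0" using p prime_gt_0_nat by blast
  define v where "v = modular_inverse (int p)"
  define X where "X = {1..int B} \<times> {-int U..int U}"
  define \<sigma> where "\<sigma> = (\<lambda>(b, y). y * v b mod int p)"
  define \<mu> where "\<mu> s = real (card {x \<in> X. \<sigma> x = s})" for s
  define K where "K m x = shifted_reciprocal_sum p A (m * v (fst x)) (\<sigma> x)" for m x
  define W where "W = {((b, y), a). (b, y) \<in> X \<and> a \<in> {1..int A} \<and> \<not> int p dvd y + a * b}"
  \<comment> \<open>The cut-off to \<open>[1, U]\<close> sits in the coefficient and not in the
    index set \<open>W\<close>, where \<open>a\<close> runs through all of \<open>[1, A]\<close>
    except for poles.\<close>
  define c where "c = (\<lambda>((b, y), a). if y + a * b \<in> {1..int U} then \<gamma> (y + a * b) else 0)"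
  define g where "g = (\<lambda>((b, y), a). v (y + a * b))"
  have finX: "finite X" by (simp add: X_def)
  have "W \<subseteq> X \<times> {1..int A}" by (auto simp: W_def)
  hence finW: "finite W" using finX by (auto intro: finite_subset)
  have \<sigma>_Fp: "\<sigma> ` X \<subseteq> Fp p" using p0 by (auto simp: \<sigma>_def Fp_def)
  have "U * 1 \<le> U * B" using \<open>1 \<le> B\<close> by (intro mult_left_mono) auto
  hence U: "U < p" using UB by linarith
  have b_nz: "\<not> int p dvd b" if "b \<in> {1..int B}" for b
    using that zdvd_not_zless[of b "int p"] U \<open>B \<le> U\<close> by auto

  have pull: "of_real (real A * real B) * (\<Sum>u\<in>{1..int U}. \<gamma> u * e_p p (m * v u)) =
        (\<Sum>w\<in>W. c w * e_p p (m * g w))" for m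
  proof -
    define f where "f u = \<gamma> u * e_p p (m * v u)" for u
    have u_nz: "\<not> int p dvd u" if "u \<in> {1..int U}" for u
      using that zdvd_not_zless[of u "int p"] U by auto
    have inner: "(\<Sum>y\<in>{-int U..int U}. if y + a * b \<in> {1..int U} then f (y + a * b) else 0) = (\<Sum>u\<in>{1..int U}. f u)"
      if ab: "a \<in> {1..int A}" "b \<in> {1..int B}" for a b
    proof -
      have "a * b \<le> int A * int B" using ab by (intro mult_mono) auto
      also have "\<dots> \<le> int U" using AB by (simp flip: of_nat_mult)
      finally have "a * b \<le> int U" .
      moreover have "a * b \<ge> 0" using ab by auto
      ultimately have "(\<Sum>y\<in>{-int U..int U}. if y + a * b \<in> {1..int U} then f (y + a * b) else 0) =
                       (\<Sum>y\<in>{1 - a * b..int U - a * b}. f (y + a * b))"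
        by (intro sum.mono_neutral_cong_right) auto
      also have "\<dots> = (\<Sum>u\<in>{1..int U}. f u)"
        by (rule sum.reindex_bij_witness[of _ "\<lambda>u. u - a * b" "\<lambda>y. y + a * b"]) auto
      finally show ?thesis .
    qed
    have "(\<Sum>w\<in>W. c w * e_p p (m * g w)) =
          (\<Sum>((b, y), a)\<in>X \<times> {1..int A}. if y + a * b \<in> {1..int U} then f (y + a * b) else 0)"
      using finX u_nz
      by (intro sum.mono_neutral_cong_left) (auto simp: W_def c_def g_def f_def split: if_splits)
    also have "\<dots> = (\<Sum>b\<in>{1..int B}. \<Sum>y\<in>{-int U..int U}. \<Sum>a\<in>{1..int A}. if y + a * b \<in> {1..int U} then f (y + a * b) else 0)"
      by (simp only: X_def sum.cartesian_product' prod.case)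
    also have "\<dots> = (\<Sum>b\<in>{1..int B}. \<Sum>a\<in>{1..int A}. \<Sum>y\<in>{-int U..int U}. if y + a * b \<in> {1..int U} then f (y + a * b) else 0)"
      by (intro sum.cong refl sum.swap)
    also have "\<dots> = (\<Sum>b\<in>{1..int B}. \<Sum>a\<in>{1..int A}. (\<Sum>u\<in>{1..int U}. f u))"
      by (intro sum.cong refl inner)
    finally show ?thesis by (simp add: f_def)
  qed
  have "(real A * real B) * norm (\<Sum>u\<in>{1..int U}. \<gamma> u * e_p p (m * v u)) =
        norm (\<Sum>w\<in>W. c w * e_p p (m * g w))" for m
    unfolding pull[symmetric] by (simp add: norm_mult)
  hence "(real A * real B) ^ (2 * r) * (\<Sum>m\<in>Fp p. norm (\<Sum>u\<in>{1..int U}. \<gamma> u * e_p p (m * v u)) ^ (2 * r)) =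
        (\<Sum>m\<in>Fp p. norm (\<Sum>w\<in>W. c w * e_p p (m * g w)) ^ (2 * r))"
    by (simp only: sum_distrib_left flip: power_mult_distrib)
  \<comment> \<open>Replacing the coefficients by 1 removes \<open>\<gamma>\<close> and the cut-off
    together and leaves complete sums over \<open>a\<close>.\<close>
  also have "\<dots> \<le> (\<Sum>m\<in>Fp p. norm (\<Sum>w\<in>W. of_real 1 * e_p p (m * g w)) ^ (2 * r))"
    using \<gamma> by (intro even_moment_Fp_mono p0 finW) (auto simp: c_def split: prod.splits)
  also have "\<dots> \<le> (\<Sum>m\<in>Fp p. (\<Sum>x\<in>X. K m x) ^ (2 * r))"
  proof (intro sum_mono power_mono)
    fix m
    have W: "W = (SIGMA x:X. {a. a \<in> {1..int A} \<and> \<not> int p dvd snd x + a * fst x})"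
      by (auto simp: W_def)
    have fin: "finite {a. a \<in> {1..int A} \<and> \<not> int p dvd snd x + a * fst x}" for x :: "int \<times> int"
      by (rule finite_subset[of _ "{1..int A}"]) auto
    have "norm (\<Sum>w\<in>W. of_real 1 * e_p p (m * g w)) =
          norm (\<Sum>x\<in>X. \<Sum>a | a \<in> {1..int A} \<and> \<not> int p dvd snd x + a * fst x. e_p p (m * v (snd x + a * fst x)))"
      unfolding W using finX fin by (subst sum.Sigma) (auto simp: g_def case_prod_unfold)
    also have "\<dots> \<le> (\<Sum>x\<in>X. norm (\<Sum>a | a \<in> {1..int A} \<and> \<not> int p dvd snd x + a * fst x. e_p p (m * v (snd x + a * fst x))))"
      by (rule norm_sum)
    also have "\<dots> = (\<Sum>x\<in>X. K m x)"
    proof (intro sum.cong refl)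
      fix x assume "x \<in> X"
      hence "\<not> int p dvd fst x" by (auto simp: X_def b_nz)
      from norm_sum_progression_eq[OF p this, where A = A and y = "snd x" and m = m]
      show "norm (\<Sum>a | a \<in> {1..int A} \<and> \<not> int p dvd snd x + a * fst x. e_p p (m * v (snd x + a * fst x))) = K m x"
        by (simp add: K_def \<sigma>_def v_def case_prod_unfold)
    qed
    finally show "norm (\<Sum>w\<in>W. of_real 1 * e_p p (m * g w)) \<le> (\<Sum>x\<in>X. K m x)" .
  qed simp
  also have "\<dots> \<le> (\<Sum>m\<in>Fp p. (\<Sum>x\<in>X. \<mu> (\<sigma> x)) ^ (2 * r - 1) * (\<Sum>x\<in>X. K m x ^ (2 * r) / \<mu> (\<sigma> x)))"
  proof (intro sum_mono)
    fix m
    have \<mu>1: "\<mu> (\<sigma> x) \<ge> 1" if "x \<in> X" for x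
    proof -
      have "x \<in> {x' \<in> X. \<sigma> x' = \<sigma> x}" using that by blast
      moreover have "finite {x' \<in> X. \<sigma> x' = \<sigma> x}" using finX by simp
      ultimately have "card {x' \<in> X. \<sigma> x' = \<sigma> x} > 0"
        by (metis card_gt_0_iff empty_iff)
      thus ?thesis by (simp add: \<mu>_def)
    qed
    \<comment> \<open>The weight \<open>\<mu>\<close> lets the factor \<open>1/\<mu>\<close> on the right cancel the multiplicity of each ratio.\<close>
    have "(\<Sum>x\<in>X. K m x) = (\<Sum>x\<in>X. \<mu> (\<sigma> x) * (K m x / \<mu> (\<sigma> x)))"
      using \<mu>1 by (intro sum.cong refl) force
    also have "\<dots> ^ (2 * r) \<le> (\<Sum>x\<in>X. \<mu> (\<sigma> x)) ^ (2 * r - 1) * (\<Sum>x\<in>X. \<mu> (\<sigma> x) * (K m x / \<mu> (\<sigma> x)) ^ (2 * r))"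
      using finX r by (intro power_mean_even) (auto simp: \<mu>_def)
    also have "\<dots> \<le> (\<Sum>x\<in>X. \<mu> (\<sigma> x)) ^ (2 * r - 1) * (\<Sum>x\<in>X. K m x ^ (2 * r) / \<mu> (\<sigma> x))"
    proof (intro mult_left_mono sum_mono)
      fix x assume "x \<in> X"
      hence 1: "\<mu> (\<sigma> x) \<ge> 1" by (rule \<mu>1)
      have "\<mu> (\<sigma> x) ^ 2 \<le> \<mu> (\<sigma> x) ^ (2 * r)"
        using r 1 by (intro power_increasing) auto
      hence "K m x ^ (2 * r) * \<mu> (\<sigma> x) ^ 2 \<le> K m x ^ (2 * r) * \<mu> (\<sigma> x) ^ (2 * r)"
        by (intro mult_left_mono) (auto simp: power_mult)
      thus "\<mu> (\<sigma> x) * (K m x / \<mu> (\<sigma> x)) ^ (2 * r) \<le> K m x ^ (2 * r) / \<mu> (\<sigma> x)"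
        using 1 by (simp add: power_divide field_simps power2_eq_square)
    qed (auto simp: \<mu>_def intro!: zero_le_power sum_nonneg)
    finally show "(\<Sum>x\<in>X. K m x) ^ (2 * r) \<le> \<dots>" .
  qed
  also have "\<dots> = (\<Sum>x\<in>X. \<mu> (\<sigma> x)) ^ (2 * r - 1) * (\<Sum>x\<in>X. \<Sum>m\<in>Fp p. K m x ^ (2 * r) / \<mu> (\<sigma> x))"
    by (subst sum.swap) (simp add: sum_distrib_left)
  also have "\<dots> \<le> (6 * real U * real B * harm B) ^ (2 * r - 1) *
           (real p * (real p * real (r ^ r) * real A ^ r + 2 * real r * real A ^ (2 * r)))"
  proof (intro mult_mono power_mono)
    \<comment> \<open>The sum of the multiplicities counts ordered pairs with the same ratio modulo
      \<open>p\<close>.\<close>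
    have "(\<Sum>x\<in>X. \<mu> (\<sigma> x)) = real (card (SIGMA x:X. {x' \<in> X. \<sigma> x' = \<sigma> x}))"
      using finX by (simp add: card_SigmaI \<mu>_def)
    also have "\<dots> \<le> real (card {(x, x') \<in> X \<times> X. snd x * fst x' = snd x' * fst x})"
    proof (intro of_nat_mono card_mono)
      show "(SIGMA x:X. {x' \<in> X. \<sigma> x' = \<sigma> x}) \<subseteq> {(x, x') \<in> X \<times> X. snd x * fst x' = snd x' * fst x}"
      proof safe
        fix b y b' y' assume x: "(b, y) \<in> X" "(b', y') \<in> X" and eq: "\<sigma> (b', y') = \<sigma> (b, y)"
        have b: "[v b'' * b'' = 1] (mod int p)" if "b'' \<in> {1..int B}" for b''
          unfolding v_def using that p b_nz by (intro cong_modular_inverse2 coprime_int_prime) auto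
        have "[y * 1 * b' = y * (v b * b) * b'] (mod int p)"
          using x by (intro cong_mult cong_refl cong_sym[OF b]) (auto simp: X_def)
        also have "y * (v b * b) * b' = (y * v b) * (b * b')" by simp
        also have "[\<dots> = (y' * v b') * (b * b')] (mod int p)"
          using eq by (intro cong_mult[OF _ cong_refl]) (simp add: \<sigma>_def cong_def)
        also have "(y' * v b') * (b * b') = y' * (v b' * b') * b" by simp
        also have "[\<dots> = y' * 1 * b] (mod int p)"
          using x by (intro cong_mult cong_refl b) (auto simp: X_def)
        finally have "int p dvd y * b' - y' * b" by (simp add: cong_iff_dvd_diff)
        moreover have "\<bar>y * b' - y' * b\<bar> < int p"
        proof -
          have "\<bar>y * b' - y' * b\<bar> \<le> \<bar>y\<bar> * \<bar>b'\<bar> + \<bar>y'\<bar> * \<bar>b\<bar>"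
            using abs_triangle_ineq4[of "y * b'" "y' * b"] by (simp add: abs_mult)
          also have "\<dots> \<le> int U * int B + int U * int B"
            using x by (intro add_mono mult_mono) (auto simp: X_def)
          also have "\<dots> = int (2 * U * B)" by simp
          also have "\<dots> < int p" using UB by (simp only: of_nat_less_iff)
          finally show ?thesis .
        qed
        ultimately have "y * b' - y' * b = 0"
          using zdvd_not_zless[of "\<bar>y * b' - y' * b\<bar>" "int p"] by (cases "y * b' - y' * b = 0") auto
        thus "snd (b, y) * fst (b', y') = snd (b', y') * fst (b, y)" by simp
      qed
    qed (use finX in \<open>auto intro: finite_subset[of _ "X \<times> X"]\<close>)
    also have "\<dots> \<le> 6 * real U * real B * harm B"
      unfolding X_def by (rule card_equal_ratios_le) fact
    finally show "(\<Sum>x\<in>X. \<mu> (\<sigma> x)) \<le> 6 * real U * real B * harm B" .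
  next
    define G where "G s = (\<Sum>l\<in>Fp p. shifted_reciprocal_sum p A l s ^ (2 * r))" for s
    have G0: "G s \<ge> 0" for s by (simp add: G_def sum_nonneg)
    have "(\<Sum>x\<in>X. \<Sum>m\<in>Fp p. K m x ^ (2 * r) / \<mu> (\<sigma> x)) = (\<Sum>x\<in>X. G (\<sigma> x) / \<mu> (\<sigma> x))"
    proof (intro sum.cong refl)
      fix x assume x: "x \<in> X"
      hence "coprime (v (fst x)) (int p)"
        unfolding v_def by (intro coprime_modular_inverse coprime_int_prime p) (auto simp: X_def b_nz)
      hence "\<not> int p dvd v (fst x)"
        using coprime_common_divisor[of "v (fst x)" "int p" "int p"] prime_gt_1_nat[OF p] by auto
      \<comment> \<open>As \<open>m\<close> runs through all residues, so does \<open>m / b\<close>;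
        the inner moment depends on \<open>x\<close> only through its ratio.\<close>
      from sum_Fp_mult[OF p this, of "\<lambda>l. shifted_reciprocal_sum p A l (\<sigma> x) ^ (2 * r)"]
      show "(\<Sum>m\<in>Fp p. K m x ^ (2 * r) / \<mu> (\<sigma> x)) = G (\<sigma> x) / \<mu> (\<sigma> x)"
        using shifted_reciprocal_sum_cong[OF p0, of _ _ A "\<sigma> x"]
        by (simp only: K_def G_def flip: sum_divide_distrib)
    qed
    also have "\<dots> = (\<Sum>s\<in>Fp p. \<Sum>x | x \<in> X \<and> \<sigma> x = s. G (\<sigma> x) / \<mu> (\<sigma> x))"
      using finX \<sigma>_Fp by (subst sum.group) auto
    also have "\<dots> = (\<Sum>s\<in>Fp p. \<mu> s * (G s / \<mu> s))"
      by (intro sum.cong refl) (simp add: \<mu>_def)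
    \<comment> \<open>An attained ratio contributes exactly \<open>G s\<close>. For an unattained
      one \<open>\<mu> s = 0\<close> and the term is 0, hence the inequality.\<close>
    also have "\<dots> \<le> (\<Sum>s\<in>Fp p. G s)"
      using G0 by (intro sum_mono) (auto simp: \<mu>_def)
    also have "\<dots> \<le> real p * (real p * real (r ^ r) * real A ^ r + 2 * real r * real A ^ (2 * r))"
      unfolding G_def by (rule shifted_reciprocal_sum_moment) fact+
    finally show "(\<Sum>x\<in>X. \<Sum>m\<in>Fp p. K m x ^ (2 * r) / \<mu> (\<sigma> x)) \<le> \<dots>" .
  qed (auto simp: \<mu>_def harm_nonneg K_def shifted_reciprocal_sum_def intro!: sum_nonneg zero_le_power mult_nonneg_nonneg divide_nonneg_nonneg)
  finally show ?thesis by (simp add: v_def)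
qed

section \<open>Partial summation, harmonic numbers and geometric sums\<close>

lemma inverse_le_sum_inverse_square:
  assumes "1 \<le> v" "v \<le> H"
  shows "1 / real v \<le> 1 / real H + (\<Sum>U\<in>{v..H}. 1 / real U ^ 2)"
proof -
  have "1 / real v - 1 / real (Suc H) = (\<Sum>U\<in>{v..H}. 1 / real U - 1 / real (Suc U))"
    using sum_Suc_diff[of v H "\<lambda>U. - (1 / real U)"] assms by simp
  also have "\<dots> \<le> (\<Sum>U\<in>{v..H}. 1 / real U ^ 2)"
  proof (intro sum_mono)
    fix U assume "U \<in> {v..H}"
    hence U: "U > 0" using assms by auto
    hence "1 / real U - 1 / real (Suc U) = 1 / (real U * real (Suc U))"
      by (simp add: field_simps)
    also have "\<dots> \<le> 1 / (real U * real U)"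
      using U by (intro divide_left_mono mult_left_mono mult_pos_pos) auto
    finally show "1 / real U - 1 / real (Suc U) \<le> 1 / real U ^ 2"
      by (simp add: power2_eq_square)
  qed
  moreover have "1 / real (Suc H) \<le> 1 / real H"
    using assms by (intro divide_left_mono) auto
  ultimately show ?thesis by linarith
qed

lemma harm_real_mono: "m \<le> n \<Longrightarrow> (harm m :: real) \<le> harm n"
  unfolding harm_def by (intro sum_mono2) auto

lemma harm_ge_1: "1 \<le> n \<Longrightarrow> (1 :: real) \<le> harm n"
  using harm_real_mono[of 1 n] by (simp add: harm_def)

lemma harm_le_1_plus_ln: "1 \<le> n \<Longrightarrow> (harm n :: real) \<le> 1 + ln (real n)"
proof (induction n rule: dec_induct)
  case (step n)
  have "ln (real n / real (Suc n)) \<le> real n / real (Suc n) - 1"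
    using step by (intro ln_le_minus_one) auto
  hence "1 / real (Suc n) \<le> ln (real (Suc n)) - ln (real n)"
    using step by (simp add: ln_div field_simps)
  thus ?case using step by (simp add: harm_Suc inverse_eq_divide)
qed (simp add: harm_def)

text \<open>With \<open>w = x / 2\<close>, monotonicity of \<open>sin y - y * cos y\<close> gives
  \<open>sin w \<ge> w * cos w\<close>. Then \<open>sin x = 2 * sin w * cos w\<close> is at least
  \<open>w\<close> times twice the square of \<open>cos w\<close>, and that factor is
  \<open>1 + cos x \<ge> 1\<close>.\<close>

lemma sin_ge_half:
  assumes "0 \<le> x" "x \<le> pi / 2"
  shows "x / 2 \<le> sin x"
proof -
  define w where "w = x / 2"
  have w: "0 \<le> w" "w \<le> pi / 4" using assms by (auto simp: w_def)
  have "sin 0 - 0 * cos 0 \<le> sin w - w * cos w"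
  proof (rule DERIV_nonneg_imp_nondecreasing[OF w(1)])
    fix y assume y: "0 \<le> y" "y \<le> w"
    have "((\<lambda>y. sin y - y * cos y) has_real_derivative y * sin y) (at y)"
      by (auto intro!: derivative_eq_intros)
    moreover have "y * sin y \<ge> 0"
      using y w by (intro mult_nonneg_nonneg sin_ge_zero) auto
    ultimately show "\<exists>d. ((\<lambda>y. sin y - y * cos y) has_real_derivative d) (at y) \<and> 0 \<le> d" by blast
  qed
  hence le: "w * cos w \<le> sin w" by simp
  have cos: "cos w \<ge> 0" using w by (intro cos_ge_zero) auto
  have "2 * (cos w)\<^sup>2 \<ge> 1"
    using cos_double_cos[of w] cos_ge_zero[of x] assms by (simp add: w_def)
  hence "w * 1 \<le> w * (2 * (cos w)\<^sup>2)"
    using w by (intro mult_left_mono)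
  also have "\<dots> = 2 * (w * cos w) * cos w" by (simp add: power2_eq_square)
  also have "\<dots> \<le> 2 * sin w * cos w"
    using le cos by (intro mult_right_mono) auto
  also have "\<dots> = sin x" using sin_double[of w] by (simp add: w_def)
  finally show ?thesis by (simp add: w_def)
qed

text \<open>The norm is twice the sine of \<open>pi * u / p\<close>, an angle in the first quadrant;
  conjugation covers the negative frequency.\<close>

lemma norm_one_minus_e_p_ge:
  assumes "p > 0" "0 < u" "2 * u \<le> int p" "y = u \<or> y = -u"
  shows "norm (1 - e_p p y) \<ge> real_of_int u / real p"
proof -
  define t where "t = pi * real_of_int u / real p"
  have "norm (1 - e_p p u) = norm (exp (\<i> * of_real (2 * t)) - 1)"
    by (simp add: e_p_def t_def norm_minus_commute mult_ac)
  also have "\<dots> = 2 * \<bar>sin t\<bar>"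
    by (subst dist_exp_i_1) simp
  finally have *: "norm (1 - e_p p u) = 2 * \<bar>sin t\<bar>" .
  have "2 * real_of_int u \<le> real p"
    using assms(3) by (metis of_int_le_iff of_int_mult of_int_numeral of_int_of_nat_eq)
  hence "0 \<le> t" "t \<le> pi / 2"
    using assms by (auto simp: t_def field_simps)
  hence "t / 2 \<le> sin t" by (rule sin_ge_half)
  hence "t \<le> norm (1 - e_p p u)" unfolding * by linarith
  moreover have "real_of_int u / real p \<le> t"
    unfolding t_def using assms pi_ge_two by (intro divide_right_mono) auto
  moreover have "norm (1 - e_p p (-u)) = norm (1 - e_p p u)"
    using complex_mod_cnj[of "1 - e_p p u"] by (simp add: cnj_e_p)
  ultimately show ?thesis using assms(4) by auto
qed

text \<open>Multiplication by \<open>1 - e_p p y\<close> telescopes the geometric sum to a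
  difference of two phases.\<close>

lemma norm_sum_e_p_interval_le:
  assumes "p > 0" "0 < u" "2 * u \<le> int p" "y = u \<or> y = -u"
  shows "norm (\<Sum>k\<in>{N0 + 1..N0 + int N}. e_p p (k * y)) \<le> 2 * real p / real_of_int u"
proof -
  let ?F = "\<lambda>N. \<Sum>k\<in>{N0 + 1..N0 + int N}. e_p p (k * y)"
  have "(1 - e_p p y) * ?F N = e_p p ((N0 + 1) * y) - e_p p ((N0 + int N + 1) * y)"
  proof (induction N)
    case (Suc N)
    have "{N0 + 1..N0 + int (Suc N)} = insert (N0 + int (Suc N)) {N0 + 1..N0 + int N}" by auto
    hence "?F (Suc N) = e_p p ((N0 + int (Suc N)) * y) + ?F N" by simp
    hence "(1 - e_p p y) * ?F (Suc N) = (1 - e_p p y) * e_p p ((N0 + int (Suc N)) * y) +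
             (e_p p ((N0 + 1) * y) - e_p p ((N0 + int N + 1) * y))"
      by (simp only: distrib_left Suc.IH)
    also have "(1 - e_p p y) * e_p p ((N0 + int (Suc N)) * y) =
               e_p p ((N0 + int N + 1) * y) - e_p p ((N0 + int (Suc N) + 1) * y)"
      by (simp add: left_diff_distrib algebra_simps flip: e_p_add)
    finally show ?case by simp
  qed simp
  hence "norm (1 - e_p p y) * norm (?F N) = norm (e_p p ((N0 + 1) * y) - e_p p ((N0 + int N + 1) * y))"
    by (simp flip: norm_mult)
  also have "\<dots> \<le> 1 + 1"
    by (rule order.trans[OF norm_triangle_ineq4]) simp
  finally have "norm (1 - e_p p y) * norm (?F N) \<le> 2" by simp
  moreover have "real_of_int u / real p * norm (?F N) \<le> norm (1 - e_p p y) * norm (?F N)"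
    by (intro mult_right_mono norm_one_minus_e_p_ge assms) auto
  ultimately have "real_of_int u / real p * norm (?F N) \<le> 2" by linarith
  thus ?thesis using assms by (simp add: field_simps)
qed

text \<open>The factor 6 comes from counting equal ratios, \<open>r ^ r\<close> and
  \<open>2 * r\<close> from diagonal and off-diagonal collisions, and \<open>8 ^ r\<close> from
  \<open>p \<le> (8 * A) ^ r\<close>.\<close>

definition moment_const :: "nat \<Rightarrow> real" where
  "moment_const r = 6 ^ (2 * r - 1) * (real (r ^ r) + 2 * real r) * 8 ^ r"

text \<open>Since \<open>A ^ r\<close> has the order of \<open>p\<close>, the collision moment is
  essentially diagonal, and a factor \<open>p / B\<close> remains to be bounded. Beyond
  \<open>U ^ (2 * r)\<close> the result depends only on the lower bound \<open>U0\<close>, as needed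
  for averaging over \<open>U\<close>.\<close>

lemma initial_interval_moment_le:
  fixes \<gamma> :: "int \<Rightarrow> complex"
  assumes p: "prime p" and r: "1 \<le> r" "r < p" and H: "p = 2 * H + 1" "1 \<le> H"
    and A: "1 \<le> A" "A ^ r \<le> p" "p \<le> (8 * A) ^ r" and U: "A \<le> U0" "U0 \<le> U" "U \<le> H"
    and \<gamma>: "\<And>u. u \<in> {1..int U} \<Longrightarrow> norm (\<gamma> u) \<le> 1"
  shows "(\<Sum>m\<in>Fp p. norm (\<Sum>u\<in>{1..int U}. \<gamma> u * e_p p (m * modular_inverse (int p) u)) ^ (2 * r))
         \<le> real U ^ (2 * r) * (moment_const r * harm p ^ (2 * r - 1) *
              (2 * real A * real p / real U0 ^ 2 + 6))" (is "?S \<le> _")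
proof -
  \<comment> \<open>This is the largest \<open>B\<close> with \<open>A * B \<le> U\<close> and
    \<open>U * B \<le> H\<close>; the latter means \<open>2 * U * B < p\<close>.\<close>
  define B where "B = min (U div A) (H div U)"
  define k where "k = real (r ^ r) + 2 * real r"
  define L where "L = (harm p :: real)"
  have pos: "0 < A" "0 < U0" "0 < U" "0 < H" "0 < p" using A U H by auto
  have B1: "1 \<le> B"
    using U pos by (simp add: B_def less_eq_div_iff_mult_less_eq)
  have "U div A * A \<le> U" by simp
  hence AB: "A * B \<le> U"
    unfolding B_def by (metis min.cobounded1 mult.commute mult_le_mono1 order.trans)
  have "H div U * U \<le> H" by simp
  hence "U * B \<le> H"
    unfolding B_def by (metis min.cobounded2 mult.commute mult_le_mono1 order.trans)
  hence UB: "2 * U * B < p" using H by simp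
  have "1 * B \<le> A * B" using A by (intro mult_right_mono) auto
  hence BU: "B \<le> U" using AB by linarith
  have "A ^ 1 \<le> A ^ r" using A r by (intro power_increasing) auto
  hence Ap: "A \<le> p" using A by simp
  have L1: "L \<ge> 1" using pos by (simp add: L_def harm_ge_1)
  have LB: "harm B \<le> L"
    unfolding L_def using BU U H by (intro harm_real_mono) auto
  have "(real A * real B) ^ (2 * r) * ?S \<le> (6 * real U * real B * harm B) ^ (2 * r - 1) *
          (real p * (real p * real (r ^ r) * real A ^ r + 2 * real r * real A ^ (2 * r)))"
    by (intro initial_interval_moment p r Ap B1 BU AB UB \<gamma>)
  also have "\<dots> \<le> (6 * real U * real B * L) ^ (2 * r - 1) * (real p * (real p * real A ^ r * k))"
  proof (intro mult_mono power_mono mult_left_mono LB)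
    \<comment> \<open>This absorbs the off-diagonal term into a multiple of the diagonal
      one.\<close>
    have "real A ^ r \<le> real p"
      using A(2) by (metis of_nat_le_iff of_nat_power)
    hence "real A ^ r * real A ^ r \<le> real p * real A ^ r"
      by (intro mult_right_mono) auto
    hence "2 * real r * (real A ^ r * real A ^ r) \<le> 2 * real r * (real p * real A ^ r)"
      by (intro mult_left_mono) auto
    hence "real p * real (r ^ r) * real A ^ r + 2 * real r * real A ^ (2 * r) \<le>
          real p * real (r ^ r) * real A ^ r + 2 * real r * (real p * real A ^ r)"
      by (simp only: mult_2[of r] power_add add_left_mono)
    also have "\<dots> = real p * real A ^ r * k"
      by (simp only: k_def distrib_left mult_ac)
    finally show "real p * real (r ^ r) * real A ^ r + 2 * real r * real A ^ (2 * r) \<le> real p * real A ^ r * k" .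
  qed (use L1 in \<open>auto intro!: mult_nonneg_nonneg add_nonneg_nonneg zero_le_power harm_nonneg\<close>)
  also have "\<dots> = (real A * real B) ^ (2 * r) *
       (6 ^ (2 * r - 1) * k * L ^ (2 * r - 1) * real U ^ (2 * r - 1) * (real p * real p / (real A ^ r * real B)))"
  proof -
    have "(real A * real B) ^ (2 * r) = real A ^ r * real A ^ r * real B ^ (2 * r - 1) * real B"
    proof -
      have "real B ^ (2 * r) = real B ^ (2 * r - 1) * real B"
        using r by (cases r) auto
      thus ?thesis by (simp add: power_mult_distrib mult_2 power_add)
    qed
    thus ?thesis
      using pos B1 by (simp add: power_mult_distrib)
  qed
  finally have S': "(real A * real B) ^ (2 * r) * ?S \<le> \<dots>" .
  have "(real A * real B) ^ (2 * r) > 0" using pos B1 by simp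
  with S' have S: "?S \<le> 6 ^ (2 * r - 1) * k * L ^ (2 * r - 1) * real U ^ (2 * r - 1) * (real p * real p / (real A ^ r * real B))"
    by (rule mult_left_le_imp_le)
  have "real p / real A ^ r \<le> 8 ^ r"
  proof -
    have "real p \<le> (8 * real A) ^ r"
      using A(3) by (metis of_nat_le_iff of_nat_power of_nat_mult of_nat_numeral)
    thus ?thesis using pos by (simp add: power_mult_distrib field_simps)
  qed
  moreover have "real p / real B \<le> real U * (2 * real A * real p / real U0 ^ 2 + 6)"
  proof -
    \<comment> \<open>Rounding down a quotient that is at least 1 loses at most a factor 2.\<close>
    have half: "real a / (2 * real b) \<le> real (a div b)" if "0 < b" "b \<le> a" for a b :: nat
    proof -
      have "a < b * (a div b) + b"
        using that mult_div_mod_eq[of b a] mod_less_divisor[of b a] by linarith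
      also have "\<dots> \<le> b * (a div b) + b * (a div b)"
      proof -
        have "1 \<le> a div b" using that by (simp add: less_eq_div_iff_mult_less_eq)
        hence "b * 1 \<le> b * (a div b)" by (intro mult_left_mono) auto
        thus ?thesis by simp
      qed
      also have "\<dots> = 2 * b * (a div b)" by simp
      finally have "real a \<le> real (2 * b * (a div b))" by (intro of_nat_mono) simp
      thus ?thesis using that by (simp add: field_simps)
    qed
    have "1 / real B \<le> 2 * real A / real U + 2 * real U / real H"
    proof (cases "U div A \<le> H div U")
      case True
      have "real U / (2 * real A) \<le> real B"
        using half[of A U] True pos U by (simp add: B_def)
      hence "1 / real B \<le> 2 * real A / real U"
        using pos B1 by (simp add: field_simps)
      thus ?thesis by (simp add: add_increasing2)
    next
      case False
      have "real H / (2 * real U) \<le> real B"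
        using half[of U H] False pos U by (simp add: B_def)
      hence "1 / real B \<le> 2 * real U / real H"
        using pos B1 by (simp add: field_simps)
      thus ?thesis by (simp add: add_increasing)
    qed
    hence "real p * (1 / real B) \<le> real p * (2 * real A / real U + 2 * real U / real H)"
      by (intro mult_left_mono) auto
    also have "\<dots> = real U * (2 * real A * real p / real U ^ 2 + 2 * (real p / real H))"
      using pos by (simp add: field_simps power2_eq_square)
    \<comment> \<open>The 3 bounds \<open>p / H\<close>, as \<open>p = 2 * H + 1\<close> and
      \<open>H \<ge> 1\<close>.\<close>
    also have "\<dots> \<le> real U * (2 * real A * real p / real U0 ^ 2 + 2 * 3)"
      using pos U H by (intro mult_left_mono add_mono divide_left_mono power_mono) (auto simp: field_simps)
    finally show ?thesis by simp
  qed
  ultimately have "(real p / real A ^ r) * (real p / real B) \<le> 8 ^ r * (real U * (2 * real A * real p / real U0 ^ 2 + 6))"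
    by (intro mult_mono) auto
  hence "6 ^ (2 * r - 1) * k * L ^ (2 * r - 1) * real U ^ (2 * r - 1) * (real p * real p / (real A ^ r * real B)) \<le>
    6 ^ (2 * r - 1) * k * L ^ (2 * r - 1) * real U ^ (2 * r - 1) * (8 ^ r * (real U * (2 * real A * real p / real U0 ^ 2 + 6)))"
    using L1 by (intro mult_left_mono) (auto simp: k_def)
  also have "\<dots> = real U ^ (2 * r) * (moment_const r * L ^ (2 * r - 1) * (2 * real A * real p / real U0 ^ 2 + 6))"
  proof -
    have "real U ^ (2 * r) = real U ^ (2 * r - 1) * real U" using r by (cases r) auto
    thus ?thesis by (simp add: moment_const_def k_def)
  qed
  finally show ?thesis using S by (simp add: L_def)
qed

subsection \<open>From the moments to sums over a set\<close>

text \<open>The ratio \<open>y = X / (M * C)\<close> satisfies \<open>y \<le> 1\<close> and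
  \<open>y ^ (2 * r) \<le> D / M\<close>. If \<open>D / M \<ge> 1\<close> the first bound suffices;
  otherwise lowering the exponent from \<open>1 / (2 * r)\<close> to \<open>\<theta>\<close> only
  weakens the second.\<close>

lemma powr_interpolate_bound:
  fixes X M C D \<theta> :: real
  assumes "X \<ge> 0" "M > 0" "C > 0" "D > 0" "r \<ge> 1" "0 \<le> \<theta>" "\<theta> \<le> 1 / (2 * real r)"
    and triv: "X \<le> M * C" and pow: "X ^ (2 * r) \<le> M ^ (2 * r - 1) * (C ^ (2 * r) * D)"
  shows "X \<le> M * C * (D / M) powr \<theta>"
proof -
  define y where "y = X / (M * C)"
  have X: "X = M * C * y" using assms by (simp add: y_def)
  have y: "0 \<le> y" "y \<le> 1" using assms by (auto simp: y_def field_simps)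
  have "y \<le> (D / M) powr \<theta>"
  proof (cases "D / M \<ge> 1 \<or> y = 0")
    case True
    thus ?thesis using y \<open>0 \<le> \<theta>\<close> ge_one_powr_ge_zero[of "D / M" \<theta>] by fastforce
  next
    case False
    have "M ^ (2 * r) = M ^ (2 * r - 1) * M" using \<open>r \<ge> 1\<close> by (cases r) auto
    hence "y ^ (2 * r) \<le> D / M"
      using pow assms by (simp add: y_def power_divide power_mult_distrib field_simps)
    hence "(y ^ (2 * r)) powr (1 / (2 * real r)) \<le> (D / M) powr (1 / (2 * real r))"
      using y by (intro powr_mono2) auto
    also have "(y ^ (2 * r)) powr (1 / (2 * real r)) = y"
    proof -
      have "y ^ (2 * r) = y powr real (2 * r)"
        using False y by (intro powr_realpow[symmetric]) auto
      thus ?thesis using False y \<open>r \<ge> 1\<close> by (simp add: powr_powr)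
    qed
    also have "(D / M) powr (1 / (2 * real r)) \<le> (D / M) powr \<theta>"
      using False assms by (intro powr_mono') auto
    finally show ?thesis .
  qed
  thus ?thesis unfolding X using assms by (intro mult_left_mono) auto
qed

text \<open>The majorant is a superposition of indicators of \<open>[1, U]\<close>, so the sum is a
  weighted mean of initial-interval sums with one bounded \<open>\<beta>\<close> for all
  \<open>U\<close>. The power mean inequality then transfers the moment bound.\<close>

lemma weighted_moment_le:
  fixes \<gamma> :: "int \<Rightarrow> complex" and c :: "nat \<Rightarrow> real" and D :: real
  assumes "1 \<le> r" and I: "finite I" "\<And>U. U \<in> I \<Longrightarrow> 0 < U \<and> U \<le> H"
    and c: "\<And>U. U \<in> I \<Longrightarrow> c U \<ge> 0"
    and moment: "\<And>U \<beta>. U \<in> I \<Longrightarrow> (\<And>u. u \<in> {1..int U} \<Longrightarrow> norm (\<beta> u) \<le> 1) \<Longrightarrow>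
      (\<Sum>m\<in>Fp p. norm (\<Sum>u\<in>{1..int U}. \<beta> u * e_p p (m * modular_inverse (int p) u)) ^ (2 * r))
        \<le> real U ^ (2 * r) * D"
    and \<gamma>: "\<And>u. u \<in> {1..int H} \<Longrightarrow> norm (\<gamma> u) \<le> (\<Sum>U | U \<in> I \<and> u \<le> int U. c U / real U)"
  shows "(\<Sum>m\<in>Fp p. norm (\<Sum>u\<in>{1..int H}. \<gamma> u * e_p p (m * modular_inverse (int p) u)) ^ (2 * r))
        \<le> (\<Sum>U\<in>I. c U) ^ (2 * r) * D"
proof -
  define \<phi> where "\<phi> u = (\<Sum>U | U \<in> I \<and> u \<le> int U. c U / real U)" for u
  \<comment> \<open>Where \<open>\<phi> u = 0\<close> the majorant forces
    \<open>\<gamma> u = 0\<close>, and division by zero gives the harmless value 0.\<close>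
  define \<beta> where "\<beta> u = \<gamma> u / of_real (\<phi> u)" for u
  have \<phi>0: "\<phi> u \<ge> 0" for u
    unfolding \<phi>_def using c by (intro sum_nonneg) auto
  have \<beta>1: "norm (\<beta> u) \<le> 1" if "u \<in> {1..int H}" for u
    using \<gamma>[OF that] \<phi>0[of u] by (cases "\<phi> u = 0") (auto simp: \<beta>_def norm_divide \<phi>_def[symmetric])
  have \<gamma>_eq: "\<gamma> u = of_real (\<phi> u) * \<beta> u" if "u \<in> {1..int H}" for u
    using \<gamma>[OF that] by (cases "\<phi> u = 0") (auto simp: \<beta>_def \<phi>_def[symmetric])
  define e where "e m u = e_p p (m * modular_inverse (int p) u)" for m u
  define W where "W m U = norm (\<Sum>u\<in>{1..int U}. \<beta> u * e m u)" for m U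
  have "norm (\<Sum>u\<in>{1..int H}. \<gamma> u * e m u) \<le> (\<Sum>U\<in>I. c U * (W m U / real U))" for m
  proof -
    have "(\<Sum>u\<in>{1..int H}. \<gamma> u * e m u) =
          (\<Sum>u\<in>{1..int H}. \<Sum>U | U \<in> I \<and> u \<le> int U. of_real (c U / real U) * (\<beta> u * e m u))"
      by (intro sum.cong refl) (simp only: \<gamma>_eq \<phi>_def of_real_sum sum_distrib_right mult.assoc)
    also have "\<dots> = (\<Sum>U\<in>I. \<Sum>u | u \<in> {1..int H} \<and> u \<le> int U. of_real (c U / real U) * (\<beta> u * e m u))"
      using I by (intro sum.swap_restrict) auto
    also have "\<dots> = (\<Sum>U\<in>I. of_real (c U / real U) * (\<Sum>u\<in>{1..int U}. \<beta> u * e m u))"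
      unfolding sum_distrib_left using I(2) by (intro sum.cong refl) force+
    also have "norm \<dots> \<le> (\<Sum>U\<in>I. norm (of_real (c U / real U) * (\<Sum>u\<in>{1..int U}. \<beta> u * e m u)))"
      by (rule norm_sum)
    also have "\<dots> = (\<Sum>U\<in>I. c U * (W m U / real U))"
      unfolding norm_mult norm_of_real W_def using c by (intro sum.cong refl) auto
    finally show ?thesis .
  qed
  hence "(\<Sum>m\<in>Fp p. norm (\<Sum>u\<in>{1..int H}. \<gamma> u * e m u) ^ (2 * r)) \<le>
        (\<Sum>m\<in>Fp p. (\<Sum>U\<in>I. c U * (W m U / real U)) ^ (2 * r))"
    by (intro sum_mono power_mono) auto
  also have "\<dots> \<le> (\<Sum>m\<in>Fp p. (\<Sum>U\<in>I. c U) ^ (2 * r - 1) * (\<Sum>U\<in>I. c U * (W m U / real U) ^ (2 * r)))"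
    using assms by (intro sum_mono power_mean_even) auto
  also have "\<dots> = (\<Sum>U\<in>I. c U) ^ (2 * r - 1) * (\<Sum>U\<in>I. \<Sum>m\<in>Fp p. c U * (W m U / real U) ^ (2 * r))"
    by (subst sum.swap) (simp add: sum_distrib_left)
  also have "\<dots> \<le> (\<Sum>U\<in>I. c U) ^ (2 * r - 1) * (\<Sum>U\<in>I. c U * D)"
  proof (intro mult_left_mono sum_mono)
    fix U assume U: "U \<in> I"
    have "(\<Sum>m\<in>Fp p. W m U ^ (2 * r)) \<le> real U ^ (2 * r) * D"
      unfolding W_def e_def using I(2)[OF U] by (intro moment U \<beta>1) auto
    hence "(\<Sum>m\<in>Fp p. (W m U / real U) ^ (2 * r)) \<le> D"
      using I(2)[OF U] by (simp add: power_divide field_simps flip: sum_divide_distrib)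
    thus "(\<Sum>m\<in>Fp p. c U * (W m U / real U) ^ (2 * r)) \<le> c U * D"
      using c[OF U] by (simp add: mult_left_mono flip: sum_distrib_left)
  qed (use c in \<open>auto intro!: sum_nonneg zero_le_power\<close>)
  also have "\<dots> = (\<Sum>U\<in>I. c U) ^ (2 * r) * D"
    using \<open>1 \<le> r\<close> by (cases r) (auto simp flip: sum_distrib_right)
  finally show ?thesis by (simp add: e_def)
qed

text \<open>The weights decomposing the majorant have total at most \<open>4 * p * harm p\<close>,
  so only a logarithm is lost. The moment bound and the trivial bound share this total and are
  interpolated.\<close>

lemma sum_inverse_phases_le:
  fixes \<gamma> :: "int \<Rightarrow> complex" and \<theta> :: real
  assumes p: "prime p" and r: "1 \<le> r" "r < p" and H: "p = 2 * H + 1" "1 \<le> H"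
    and A: "1 \<le> A" "A ^ r \<le> p" "p \<le> (8 * A) ^ r" and U: "A \<le> U0" "U0 \<le> H"
    and \<theta>: "0 \<le> \<theta>" "\<theta> \<le> 1 / (2 * real r)"
    and M: "M \<subseteq> Fp p" "card M \<ge> 1"
    and \<gamma>: "\<And>u. u \<in> {1..int H} \<Longrightarrow> norm (\<gamma> u) \<le> 2 * real p / real_of_int (max u (int U0))"
  shows "(\<Sum>m\<in>M. norm (\<Sum>u\<in>{1..int H}. \<gamma> u * e_p p (m * modular_inverse (int p) u))) \<le>
      real (card M) * (4 * real p * harm p) *
        (moment_const r * harm p ^ (2 * r - 1) * (2 * real A * real p / real U0 ^ 2 + 6) / real (card M)) powr \<theta>"
proof -
  define L where "L = (harm p :: real)"
  define D where "D = moment_const r * L ^ (2 * r - 1) * (2 * real A * real p / real U0 ^ 2 + 6)"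
  \<comment> \<open>Chosen so that the sum of \<open>c U / U\<close> over \<open>U \<ge> u\<close> majorises \<open>2 p / max u U0\<close>.\<close>
  define c where "c U = 2 * real p / real U + (if U = H then 2 * real p else 0)" for U
  define V where "V m = norm (\<Sum>u\<in>{1..int H}. \<gamma> u * e_p p (m * modular_inverse (int p) u))" for m
  have pos: "0 < U0" "0 < p" using A U H by auto
  have L1: "L \<ge> 1" using pos by (simp add: L_def harm_ge_1)
  have finM: "finite M" using M finite_subset finite_Fp by blast
  have c0: "c U \<ge> 0" for U by (simp add: c_def)
  \<comment> \<open>The sum of \<open>1 / U\<close> costs one \<open>harm p\<close>; the extra
    \<open>2 * p\<close> at \<open>U = H\<close> is absorbed because
    \<open>harm p \<ge> 1\<close>.\<close>
  have sum_c: "(\<Sum>U\<in>{U0..H}. c U) \<le> 4 * real p * L"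
  proof -
    have "(\<Sum>U\<in>{U0..H}. c U) = 2 * real p * (\<Sum>U\<in>{U0..H}. inverse (real U)) + 2 * real p"
      using U by (simp add: c_def sum.distrib sum_distrib_left inverse_eq_divide)
    also have "(\<Sum>U\<in>{U0..H}. inverse (real U)) \<le> L"
      unfolding L_def harm_def using pos H by (intro sum_mono2) auto
    also have "2 * real p * L + 2 * real p \<le> 4 * real p * L"
      using mult_left_mono[OF L1, of "2 * real p"] by linarith
    finally show ?thesis by (simp add: mult_left_mono)
  qed
  have \<gamma>_le: "norm (\<gamma> u) \<le> (\<Sum>U | U \<in> {U0..H} \<and> u \<le> int U. c U / real U)" if u: "u \<in> {1..int H}" for u
  proof -
    define v where "v = max (nat u) U0"
    have v: "1 \<le> v" "v \<le> H" "int v = max u (int U0)" using u U pos by (auto simp: v_def)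
    have set: "{U. U \<in> {U0..H} \<and> u \<le> int U} = {v..H}" using u by (auto simp: v_def)
    have "norm (\<gamma> u) \<le> 2 * real p * (1 / real v)"
      using \<gamma>[OF u] by (simp flip: v(3))
    also have "\<dots> \<le> 2 * real p * (1 / real H + (\<Sum>U\<in>{v..H}. 1 / real U ^ 2))"
      by (intro mult_left_mono inverse_le_sum_inverse_square v) auto
    also have "\<dots> = (\<Sum>U\<in>{v..H}. (if U = H then 2 * real p / real H else 0) + 2 * real p * (1 / real U ^ 2))"
      using v by (simp add: sum.distrib distrib_left sum_distrib_left)
    also have "\<dots> = (\<Sum>U\<in>{v..H}. c U / real U)"
      by (intro sum.cong refl) (auto simp: c_def power2_eq_square add_divide_distrib)
    finally show ?thesis by (simp only: set)
  qed
  have "(\<Sum>m\<in>Fp p. V m ^ (2 * r)) \<le> (\<Sum>U\<in>{U0..H}. c U) ^ (2 * r) * D"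
    unfolding V_def
  proof (rule weighted_moment_le[OF r(1) _ _ c0 _ \<gamma>_le])
    fix U and \<beta> :: "int \<Rightarrow> complex"
    assume "U \<in> {U0..H}" "\<And>u. u \<in> {1..int U} \<Longrightarrow> norm (\<beta> u) \<le> 1"
    thus "(\<Sum>m\<in>Fp p. norm (\<Sum>u\<in>{1..int U}. \<beta> u * e_p p (m * modular_inverse (int p) u)) ^ (2 * r)) \<le> real U ^ (2 * r) * D"
      unfolding D_def L_def using U by (intro initial_interval_moment_le[OF p r H A U(1)]) auto
  qed (use pos in auto)
  also have "\<dots> \<le> (4 * real p * L) ^ (2 * r) * D"
    using sum_c L1 by (intro mult_right_mono power_mono)
      (auto simp: D_def moment_const_def intro!: sum_nonneg c0)
  finally have moment: "(\<Sum>m\<in>Fp p. V m ^ (2 * r)) \<le> (4 * real p * L) ^ (2 * r) * D" .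
  have "(\<Sum>m\<in>M. V m) \<le> real (card M) * (4 * real p * L) * (D / real (card M)) powr \<theta>"
  proof (rule powr_interpolate_bound[OF _ _ _ _ r(1) \<theta>])
    show "D > 0"
      unfolding D_def moment_const_def using L1 r
      by (intro mult_pos_pos add_nonneg_pos add_pos_pos zero_less_power) auto
    show "(\<Sum>m\<in>M. V m) \<le> real (card M) * (4 * real p * L)"
    proof (rule sum_bounded_above)
      fix m
      have "V m \<le> (\<Sum>u\<in>{1..int H}. norm (\<gamma> u * e_p p (m * modular_inverse (int p) u)))"
        unfolding V_def by (rule norm_sum)
      also have "\<dots> \<le> (\<Sum>u\<in>{1..int H}. \<Sum>U | U \<in> {U0..H} \<and> u \<le> int U. c U / real U)"
        by (intro sum_mono) (simp only: norm_mult norm_e_p mult_1_right \<gamma>_le)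
      \<comment> \<open>Each \<open>c U / U\<close> is counted for \<open>U\<close> values of
        \<open>u\<close>, so the total weight reappears.\<close>
      also have "\<dots> = (\<Sum>U\<in>{U0..H}. \<Sum>u | u \<in> {1..int H} \<and> u \<le> int U. c U / real U)"
        by (intro sum.swap_restrict) auto
      also have "\<dots> = (\<Sum>U\<in>{U0..H}. c U)"
      proof (intro sum.cong refl)
        fix U assume U: "U \<in> {U0..H}"
        hence "{u. u \<in> {1..int H} \<and> u \<le> int U} = {1..int U}" by auto
        thus "(\<Sum>u | u \<in> {1..int H} \<and> u \<le> int U. c U / real U) = c U"
          using U pos by simp
      qed
      also note sum_c
      finally show "V m \<le> 4 * real p * L" .
    qed
    \<comment> \<open>Hoelder's inequality over \<open>M\<close>; by positivity the moment is then
      extended to all residues.\<close>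
    have "(\<Sum>m\<in>M. 1 * V m) ^ (2 * r) \<le> (\<Sum>m\<in>M. 1) ^ (2 * r - 1) * (\<Sum>m\<in>M. 1 * V m ^ (2 * r))"
      using finM r by (intro power_mean_even) auto
    also have "(\<Sum>m\<in>M. 1 * V m ^ (2 * r)) \<le> (\<Sum>m\<in>Fp p. V m ^ (2 * r))"
      using M by (auto intro!: sum_mono2 simp: power_mult)
    also note moment
    finally show "(\<Sum>m\<in>M. V m) ^ (2 * r) \<le> real (card M) ^ (2 * r - 1) * ((4 * real p * L) ^ (2 * r) * D)"
      by (simp add: mult_left_mono)
  qed (use M L1 pos in \<open>auto intro!: sum_nonneg simp: V_def\<close>)
  thus ?thesis by (simp add: V_def D_def L_def)
qed

text \<open>After the substitution \<open>x = 1/y\<close>, the residues are split into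
  \<open>u\<close> and \<open>p - u\<close> with \<open>u \<le> H\<close>. As
  \<open>1/(p - u) = -1/u\<close>, conjugating the second half gives it the phases of the
  first.\<close>

lemma sum_kloosterman_eq:
  fixes J :: "int set"
  assumes p: "prime p" and H: "p = 2 * H + 1"
  defines "F \<equiv> \<lambda>y. \<Sum>n\<in>J. e_p p (n * y)"
  shows "(\<Sum>n\<in>J. kloosterman p m n) =
           (\<Sum>u\<in>{1..int H}. F u * e_p p (m * modular_inverse (int p) u)) +
           cnj (\<Sum>u\<in>{1..int H}. cnj (F (-u)) * e_p p (m * modular_inverse (int p) u))"
proof -
  define v where "v = modular_inverse (int p)"
  have p1: "p > 1" using p prime_gt_1_nat by blast
  have nz: "\<not> int p dvd x" if "x \<in> Fp_units p" for x
    using that zdvd_not_zless[of x "int p"] by (auto simp: Fp_units_def Fp_def)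
  have v_units: "v x \<in> Fp_units p" and vv: "v (v x) = x" if x: "x \<in> Fp_units p" for x
  proof -
    have cong: "[v x * x = 1] (mod int p)"
      unfolding v_def by (intro cong_modular_inverse2 coprime_int_prime p nz x)
    have "v x \<noteq> 0"
    proof
      assume "v x = 0"
      with cong have "int p dvd 1" by (simp add: cong_iff_dvd_diff)
      thus False using p1 by simp
    qed
    thus "v x \<in> Fp_units p"
      using p1 by (simp add: Fp_units_def Fp_def v_def modular_inverse_int_nonneg modular_inverse_int_less)
    show "v (v x) = x"
      unfolding v_def using x cong by (intro modular_inverse_int_eqI) (auto simp: Fp_units_def Fp_def v_def)
  qed
  have "(\<Sum>n\<in>J. kloosterman p m n) = (\<Sum>x\<in>Fp_units p. \<Sum>n\<in>J. e_p p (n * v x) * e_p p (m * x))"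
    unfolding kloosterman_def v_def by (subst sum.swap) (simp add: e_p_add mult.commute)
  also have "\<dots> = (\<Sum>x\<in>Fp_units p. F (v x) * e_p p (m * x))"
    by (simp add: F_def sum_distrib_right)
  also have "\<dots> = (\<Sum>y\<in>Fp_units p. F y * e_p p (m * v y))"
    by (rule sum.reindex_bij_witness[of _ v v]) (auto simp: v_units vv)
  also have "Fp_units p = {1..int H} \<union> {int H + 1..2 * int H}"
    using H by (auto simp: Fp_units_def Fp_def)
  also have "(\<Sum>y\<in>{1..int H} \<union> {int H + 1..2 * int H}. F y * e_p p (m * v y)) =
         (\<Sum>u\<in>{1..int H}. F u * e_p p (m * v u)) + (\<Sum>y\<in>{int H + 1..2 * int H}. F y * e_p p (m * v y))"
    by (rule sum.union_disjoint) auto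
  also have "(\<Sum>y\<in>{int H + 1..2 * int H}. F y * e_p p (m * v y)) =
             (\<Sum>u\<in>{1..int H}. F (int p - u) * e_p p (m * v (int p - u)))"
    by (rule sum.reindex_bij_witness[of _ "\<lambda>u. int p - u" "\<lambda>u. int p - u"]) (auto simp: H)
  also have "\<dots> = (\<Sum>u\<in>{1..int H}. F (-u) * e_p p (- (m * v u)))"
  proof (intro sum.cong refl arg_cong2[of _ _ _ _ "(*)"])
    fix u assume u: "u \<in> {1..int H}"
    have "[int p - u = -u] (mod int p)" by (simp add: cong_iff_dvd_diff)
    thus "F (int p - u) = F (-u)"
      unfolding F_def using p1 by (intro sum.cong refl e_p_cong cong_mult cong_refl) auto
    have u': "u \<in> Fp_units p" "int p - u \<in> Fp_units p" using u H by (auto simp: Fp_units_def Fp_def)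
    \<comment> \<open>Adding the two congruences shows that \<open>v (int p - u) + v u\<close> is
      congruent to a multiple of \<open>p\<close>.\<close>
    have "[v (int p - u) * (u * v u) = v (int p - u) * 1] (mod int p)"
      unfolding v_def using u' by (intro cong_mult cong_refl cong_modular_inverse1 coprime_int_prime p nz)
    moreover have "[v (int p - u) * (int p - u) * v u = 1 * v u] (mod int p)"
      unfolding v_def using u' by (intro cong_mult cong_refl cong_modular_inverse2 coprime_int_prime p nz)
    ultimately have "int p dvd int p * (v (int p - u) * v u) -
       ((v (int p - u) * (u * v u) - v (int p - u) * 1) + (v (int p - u) * (int p - u) * v u - 1 * v u))"
      unfolding cong_iff_dvd_diff by (intro dvd_diff[OF dvd_triv_left] dvd_add)
    hence "[v (int p - u) = - v u] (mod int p)"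
      unfolding cong_iff_dvd_diff by (simp add: algebra_simps)
    hence "[m * v (int p - u) = m * (- v u)] (mod int p)"
      by (intro cong_mult cong_refl)
    thus "e_p p (m * v (int p - u)) = e_p p (- (m * v u))"
      using p1 by (intro e_p_cong) auto
  qed
  also have "\<dots> = cnj (\<Sum>u\<in>{1..int H}. cnj (F (-u)) * e_p p (m * v u))"
    by (simp add: cnj_e_p)
  finally show ?thesis by (simp add: v_def)
qed

subsection \<open>Kloosterman sums\<close>

text \<open>\<open>N \<le> p\<close> makes reduction modulo \<open>p\<close> injective on the
  integer interval, so wrapping around changes neither the sum nor the number of terms.\<close>

lemma norm_sum_interval_le:
  assumes "p > 0" "Fp_interval p N J" "N \<le> p" "0 < u" "2 * u \<le> int p" "y = u \<or> y = -u"
  shows "norm (\<Sum>n\<in>J. e_p p (n * y)) \<le> min (real N) (2 * real p / real_of_int u)"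
proof -
  obtain N0 where J: "J = (\<lambda>k. k mod int p) ` {N0 + 1..N0 + int N}"
    using assms by (auto simp: Fp_interval_def)
  have "inj_on (\<lambda>k. k mod int p) {N0 + 1..N0 + int N}"
  proof (rule inj_onI)
    fix k l assume kl: "k \<in> {N0 + 1..N0 + int N}" "l \<in> {N0 + 1..N0 + int N}" "k mod int p = l mod int p"
    hence "int p dvd k - l" by (simp add: mod_eq_dvd_iff)
    moreover have "\<bar>k - l\<bar> < int p" using kl(1,2) \<open>N \<le> p\<close> by auto
    ultimately show "k = l"
      using zdvd_not_zless[of "\<bar>k - l\<bar>" "int p"] by (cases "k = l") auto
  qed
  hence eq: "(\<Sum>n\<in>J. e_p p (n * y)) = (\<Sum>k\<in>{N0 + 1..N0 + int N}. e_p p (k mod int p * y))"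
    unfolding J by (subst sum.reindex) auto
  also have "\<dots> = (\<Sum>k\<in>{N0 + 1..N0 + int N}. e_p p (k * y))"
    using assms(1) by (intro sum.cong refl e_p_cong) (auto simp: cong_def mod_mult_left_eq)
  finally have *: "(\<Sum>n\<in>J. e_p p (n * y)) = (\<Sum>k\<in>{N0 + 1..N0 + int N}. e_p p (k * y))" .
  have "norm (\<Sum>n\<in>J. e_p p (n * y)) \<le> (\<Sum>k\<in>{N0 + 1..N0 + int N}. norm (e_p p (k * y)))"
    unfolding * by (rule norm_sum)
  also have "\<dots> = real N" by simp
  finally show ?thesis
    unfolding * using norm_sum_e_p_interval_le[OF assms(1,4-6), of N0 N] by simp
qed

lemma one_plus_powr_le:
  fixes x \<theta> :: real
  assumes "x \<ge> 0" "0 \<le> \<theta>" "\<theta> \<le> 1"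
  shows "(1 + x) powr \<theta> \<le> 2 * (1 + x powr \<theta>)"
proof -
  have "(1 + x) powr \<theta> \<le> (2 * max 1 x) powr \<theta>"
    using assms by (intro powr_mono2) auto
  also have "\<dots> = 2 powr \<theta> * max 1 x powr \<theta>"
    by (rule powr_mult)
  also have "\<dots> \<le> 2 powr 1 * (1 + x powr \<theta>)"
    using assms by (intro mult_mono powr_mono) (auto simp: max_def)
  finally show ?thesis by simp
qed

lemma moment_const_ge_1: "r \<ge> 1 \<Longrightarrow> moment_const r \<ge> 1"
proof -
  assume "r \<ge> 1"
  have "1 * 1 * 1 \<le> 6 ^ (2 * r - 1) * (real (r ^ r) + 2 * real r) * (8 ^ r :: real)"
    using \<open>r \<ge> 1\<close> by (intro mult_mono) (auto intro: add_increasing)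
  thus ?thesis by (simp add: moment_const_def)
qed

text \<open>The parameters are \<open>A\<close> of order \<open>p powr (1 / r)\<close> and
  \<open>U0\<close> of order \<open>p / N\<close>; the hypothesis on \<open>N\<close> ensures
  \<open>A \<le> U0\<close>. One factor \<open>harm p\<close> comes from the weights, the other from
  the moment bound.\<close>

lemma interval_kloosterman_bound:
  fixes p r N :: nat and \<alpha> :: "int \<Rightarrow> complex"
  assumes p: "prime p" "8 ^ r \<le> p" and r: "r \<ge> 1"
    and M: "M \<subseteq> Fp p" "card M \<ge> 1" and J: "Fp_interval p N J"
    and N: "1 \<le> N" "real N \<le> real p powr (1 - 1 / real r)"
    and \<alpha>: "\<And>m. m \<in> M \<Longrightarrow> norm (\<alpha> m) \<le> K"
    and \<theta>: "0 \<le> \<theta>" "\<theta> \<le> 1 / (2 * real r)"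
  shows "norm (\<Sum>m\<in>M. \<Sum>n\<in>J. \<alpha> m * kloosterman p m n) \<le>
     288 * moment_const r * K * real (card M) * real p * harm p ^ 2 *
       ((1 + (real N ^ 2 * real p powr (1 / real r - 1)) powr \<theta>) / real (card M) powr \<theta>)"
proof -
  define L where "L = (harm p :: real)"
  define Q where "Q = real N ^ 2 * real p powr (1 / real r - 1)"
  define H where "H = (p - 1) div 2"
  have "8 ^ 1 \<le> (8 :: nat) ^ r" using r by (intro power_increasing) auto
  hence p8: "p \<ge> 8" using p by simp
  have "odd p" using p(1) p8 prime_odd_nat by auto
  hence H: "p = 2 * H + 1" "1 \<le> H" using p8 by (auto simp: H_def elim!: oddE)
  have "r < 8 ^ r" by (rule less_exp[THEN order.strict_trans2]) (simp add: power_mono)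
  hence rp: "r < p" using p by linarith
  have p0: "real p > 0" using p8 by simp
  have L1: "L \<ge> 1" using p8 by (simp add: L_def harm_ge_1)
  define w where "w = real p powr (1 / real r)"
  have w_pow: "w ^ r = real p"
    using r p0 by (simp add: w_def powr_powr flip: powr_realpow)
  have w0: "w > 0" using p0 by (simp add: w_def)
  have w8: "w \<ge> 8"
  proof (rule power_le_imp_le_base)
    show "(8 :: real) ^ Suc (r - 1) \<le> w ^ Suc (r - 1)"
      using p(2) r by (simp add: w_pow)
  qed (use w0 in auto)
  have wp: "w \<le> real p"
    using powr_mono[of "1 / real r" 1 "real p"] p8 r by (simp add: w_def)
  \<comment> \<open>From \<open>w \<ge> 8\<close>, rounding \<open>w / 4\<close> down still leaves
    \<open>8 * A \<ge> w\<close>. The divisor 4 gives \<open>A \<le> p / 4\<close>, hence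
    \<open>A \<le> H\<close>, even for \<open>r = 1\<close>.\<close>
  define A where "A = nat \<lfloor>w / 4\<rfloor>"
  have A_le: "real A \<le> w / 4" using w0 of_int_floor_le[of "w / 4"] by (simp add: A_def)
  have A_ge: "w \<le> 8 * real A"
  proof -
    have "w / 4 < real A + 1" using w0 by (simp add: A_def)
    thus ?thesis using w8 by linarith
  qed
  have A: "1 \<le> A" "A ^ r \<le> p" "p \<le> (8 * A) ^ r"
  proof -
    show "1 \<le> A" using A_ge w8 by linarith
    have "real A ^ r \<le> w ^ r" using A_le w0 by (intro power_mono) auto
    thus "A ^ r \<le> p" unfolding w_pow by (metis of_nat_le_iff of_nat_power)
    have "w ^ r \<le> (8 * real A) ^ r" using A_ge w0 by (intro power_mono) auto
    thus "p \<le> (8 * A) ^ r" unfolding w_pow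
      by (metis of_nat_le_iff of_nat_power of_nat_mult of_nat_numeral)
  qed
  have Nw: "real N * w \<le> real p"
  proof -
    have "real N * w \<le> real p powr (1 - 1 / real r) * real p powr (1 / real r)"
      unfolding w_def using N by (intro mult_right_mono) auto
    also have "\<dots> = real p" using p0 by (simp flip: powr_add)
    finally show ?thesis .
  qed
  have Np: "N \<le> p"
  proof -
    have "real N * 1 \<le> real N * w" using w8 by (intro mult_left_mono) auto
    with Nw show ?thesis by simp
  qed
  \<comment> \<open>Near \<open>p / N\<close> the trivial bound \<open>N\<close> and the geometric
    bound \<open>2 * p / u\<close> have the same order; the cap \<open>H\<close> matters for very
    small \<open>N\<close>.\<close>
  define U0 where "U0 = min (nat \<lceil>real p / real N\<rceil>) H"
  have U0_H: "U0 \<le> H" by (simp add: U0_def)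
  have Hp: "real H \<ge> real p / 3" using H by simp
  have A_U0: "A \<le> U0"
  proof -
    have "w \<le> real p / real N" using Nw N by (simp add: field_simps)
    hence "real A \<le> real_of_int \<lceil>real p / real N\<rceil>" using A_le w0 by linarith
    moreover have "real A \<le> real H" using A_le wp Hp p0 by linarith
    ultimately show ?thesis by (simp add: U0_def)
  qed
  have U0_N: "real N * real U0 \<le> 2 * real p"
  proof -
    have "real U0 \<le> real p / real N + 1"
      unfolding U0_def using p0 N by (simp add: min_def)
    hence "real N * real U0 \<le> real N * (real p / real N + 1)" by (intro mult_left_mono) auto
    also have "\<dots> = real p + real N" using N by (simp add: field_simps)
    finally show ?thesis using Np by simp
  qed
  \<comment> \<open>The 3 covers the capped case, where \<open>U0 = H \<ge> p / 3\<close>.\<close>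
  have U0_ge: "real U0 \<ge> real p / (3 * real N)"
  proof -
    have "real p / (3 * real N) \<le> real p / real N" using N p0 by (intro divide_left_mono) auto
    hence "real p / (3 * real N) \<le> real (nat \<lceil>real p / real N\<rceil>)" by linarith
    moreover have "real p / (3 * real N) \<le> real p / 3" using N p0 by (intro divide_left_mono) auto
    ultimately show ?thesis using Hp by (simp add: U0_def min_def)
  qed
  define F where "F y = (\<Sum>n\<in>J. e_p p (n * y))" for y
  have F_le: "norm (F y) \<le> 2 * real p / real_of_int (max u (int U0))"
    if u: "u \<in> {1..int H}" and y: "y = u \<or> y = -u" for u y
  proof -
    have le: "norm (F y) \<le> min (real N) (2 * real p / real_of_int u)"
      unfolding F_def using J Np u y H p0 by (intro norm_sum_interval_le) auto
    show ?thesis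
    proof (cases "u \<le> int U0")
      case True
      have "real N \<le> 2 * real p / real U0"
        using U0_N True u by (simp add: field_simps)
      with le True show ?thesis by (simp add: max_def)
    qed (use le in \<open>simp add: max_def\<close>)
  qed
  define V1 where "V1 m = (\<Sum>u\<in>{1..int H}. F u * e_p p (m * modular_inverse (int p) u))" for m
  define V2 where "V2 m = (\<Sum>u\<in>{1..int H}. cnj (F (-u)) * e_p p (m * modular_inverse (int p) u))" for m
  define D where "D = moment_const r * L ^ (2 * r - 1) * (2 * real A * real p / real U0 ^ 2 + 6)"
  define G where "G = real (card M) * (4 * real p * L) * (D / real (card M)) powr \<theta>"
  have V1: "(\<Sum>m\<in>M. norm (V1 m)) \<le> G"
    unfolding V1_def G_def D_def L_def
    by (intro sum_inverse_phases_le[OF p(1) r rp H A A_U0 U0_H \<theta> M] F_le) auto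
  have V2: "(\<Sum>m\<in>M. norm (V2 m)) \<le> G"
    unfolding V2_def G_def D_def L_def
    by (intro sum_inverse_phases_le[OF p(1) r rp H A A_U0 U0_H \<theta> M]) (auto intro!: F_le)
  have finM: "finite M" using M finite_subset finite_Fp by blast
  have "K \<ge> 0"
  proof -
    obtain m where "m \<in> M" using M(2) by (metis card.empty equals0I not_one_le_zero)
    from \<alpha>[OF this] show ?thesis by (rule order.trans[OF norm_ge_zero])
  qed
  have "norm (\<Sum>m\<in>M. \<Sum>n\<in>J. \<alpha> m * kloosterman p m n) = norm (\<Sum>m\<in>M. \<alpha> m * (V1 m + cnj (V2 m)))"
    by (simp add: sum_kloosterman_eq[OF p(1) H(1)] V1_def V2_def F_def flip: sum_distrib_left)
  also have "\<dots> \<le> (\<Sum>m\<in>M. norm (\<alpha> m * (V1 m + cnj (V2 m))))" by (rule norm_sum)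
  also have "\<dots> \<le> (\<Sum>m\<in>M. K * (norm (V1 m) + norm (V2 m)))"
    unfolding norm_mult using \<alpha> \<open>K \<ge> 0\<close>
    by (intro sum_mono mult_mono order.trans[OF norm_triangle_ineq]) auto
  also have "\<dots> = K * ((\<Sum>m\<in>M. norm (V1 m)) + (\<Sum>m\<in>M. norm (V2 m)))"
    by (simp add: sum_distrib_left sum.distrib distrib_left)
  also have "\<dots> \<le> K * (G + G)"
    using V1 V2 \<open>K \<ge> 0\<close> by (intro mult_left_mono add_mono)
  finally have S: "norm (\<Sum>m\<in>M. \<Sum>n\<in>J. \<alpha> m * kloosterman p m n) \<le> K * (G + G)" .
  have \<theta>1: "\<theta> \<le> 1"
  proof -
    have "1 / (2 * real r) \<le> 1" using r by simp
    thus ?thesis using \<theta> by linarith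
  qed
  have mc: "moment_const r \<ge> 1" using r by (rule moment_const_ge_1)
  \<comment> \<open>The 18 is 2 times the square of the 3 in \<open>U0_ge\<close>; it also dominates
    the summand 6.\<close>
  have D_le: "D \<le> (18 * moment_const r) * L ^ (2 * r - 1) * (1 + Q)"
  proof -
    have "2 * real A * real p / real U0 ^ 2 \<le> 2 * w * real p / (real p / (3 * real N)) ^ 2"
      using A_le w0 U0_ge p0 N A_U0 A by (intro frac_le mult_mono power_mono) auto
    also have "\<dots> = 18 * (real N ^ 2 * (w / real p))"
      using p0 N by (simp add: field_simps power2_eq_square)
    also have "w / real p = real p powr (1 / real r - 1)"
      using p0 by (simp add: w_def powr_diff)
    finally have "2 * real A * real p / real U0 ^ 2 + 6 \<le> 18 * (1 + Q)"
      by (simp add: Q_def)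
    hence "moment_const r * L ^ (2 * r - 1) * (2 * real A * real p / real U0 ^ 2 + 6) \<le>
           moment_const r * L ^ (2 * r - 1) * (18 * (1 + Q))"
      using mc L1 by (intro mult_left_mono) auto
    thus ?thesis unfolding D_def by (simp only: mult_ac)
  qed
  have Q0: "Q \<ge> 0" by (simp add: Q_def)
  have "D \<ge> 0" unfolding D_def using mc L1 by auto
  hence "D powr \<theta> \<le> ((18 * moment_const r) * L ^ (2 * r - 1) * (1 + Q)) powr \<theta>"
    using D_le \<theta> by (intro powr_mono2) auto
  also have "\<dots> = (18 * moment_const r) powr \<theta> * (L ^ (2 * r - 1)) powr \<theta> * (1 + Q) powr \<theta>"
    by (simp only: powr_mult)
  also have "\<dots> \<le> (18 * moment_const r) powr 1 * L * (2 * (1 + Q powr \<theta>))"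
  proof (intro mult_mono one_plus_powr_le powr_mono)
    \<comment> \<open>Since \<open>(2 * r - 1) * \<theta> \<le> 1\<close>, the moment bound
      contributes at most one factor \<open>L\<close>.\<close>
    have "(L ^ (2 * r - 1)) powr \<theta> = L powr (real (2 * r - 1) * \<theta>)"
      using L1 by (simp add: powr_powr flip: powr_realpow)
    also have "\<dots> \<le> L powr 1"
    proof (intro powr_mono)
      have "real (2 * r - 1) * \<theta> \<le> (2 * real r) * (1 / (2 * real r))"
        using \<theta> r by (intro mult_mono) auto
      thus "real (2 * r - 1) * \<theta> \<le> 1" using r by simp
    qed (use L1 in auto)
    finally show "(L ^ (2 * r - 1)) powr \<theta> \<le> L" using L1 by simp
  qed (use mc L1 Q0 \<theta> \<theta>1 in auto)
  finally have D_powr: "D powr \<theta> \<le> 36 * moment_const r * L * (1 + Q powr \<theta>)"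
    using mc by (simp add: algebra_simps)
  \<comment> \<open>Each half contributes a factor 4; the resulting 8 times 36 is the final
    288.\<close>
  have "K * (G + G) = 8 * K * real (card M) * real p * L * (D powr \<theta> / real (card M) powr \<theta>)"
    by (simp add: G_def powr_divide)
  also have "\<dots> \<le> 8 * K * real (card M) * real p * L *
       ((36 * moment_const r * L * (1 + Q powr \<theta>)) / real (card M) powr \<theta>)"
    using D_powr \<open>K \<ge> 0\<close> L1 by (intro mult_left_mono divide_right_mono) auto
  finally show ?thesis using S by (simp add: Q_def L_def power2_eq_square mult_ac)
qed

text \<open>The exponent \<open>\<theta> = 7 / (24 * r)\<close> is admissible because it is below
  \<open>12 / (24 * r) = 1 / (2 * r)\<close>. The logarithms are absorbed into
  \<open>p powr \<epsilon>\<close>, and the two summands come from separating 1 and the power of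
  \<open>N\<close> in the general bound.\<close>

theorem theorem2p7:
  fixes r :: nat and \<epsilon> :: real
  assumes "r \<ge> 1" and "\<epsilon> > 0"
  shows "\<exists>C > (0::real). \<exists>p0 :: nat. \<forall>p :: nat. prime p \<longrightarrow> p \<ge> p0 \<longrightarrow>
    (\<forall>(M :: int set) (J :: int set) (N :: nat) (\<alpha> :: int \<Rightarrow> complex).
       M \<subseteq> Fp p \<longrightarrow> card M \<ge> 1 \<longrightarrow>
       J \<subseteq> Fp_units p \<longrightarrow> Fp_interval p N J \<longrightarrow>
       1 \<le> N \<longrightarrow> real N \<le> real p powr (1 - 1 / real r) \<longrightarrow>
       cmod (\<Sum>m\<in>M. \<Sum>n\<in>J. \<alpha> m * kloosterman p m n)
         \<le> C * sup_norm_on M \<alpha> * real (card M) * real N * real p powr (1/2 + \<epsilon>) *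
            (real p powr (1/2) / (real (card M) powr (7 / (24 * real r)) * real N)
             + real p powr (1/2 - 7 * (real r - 1) / (24 * (real r)\<^sup>2))
               / (real (card M) powr (7 / (24 * real r))
                  * real N powr (1 - 7 / (12 * real r)))))"
proof -
  \<comment> \<open>The square of the constant in \<open>1 + ln p \<le> (1 + 2 / \<epsilon>) * p
    powr (\<epsilon> / 2)\<close>.\<close>
  define E where "E = (1 + 2 / \<epsilon>) ^ 2"
  define C where "C = 288 * moment_const r * E"
  have mc: "moment_const r \<ge> 1" using assms(1) by (rule moment_const_ge_1)
  have E0: "E > 0" using \<open>\<epsilon> > 0\<close> unfolding E_def by (intro zero_less_power add_pos_pos) auto
  show ?thesis
  proof (rule exI[of _ C], intro conjI exI[of _ "8 ^ r"] allI impI)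
    show "C > 0" using mc E0 by (simp add: C_def)
  next
    fix p :: nat and M J :: "int set" and N :: nat and \<alpha> :: "int \<Rightarrow> complex"
    assume p: "prime p" "8 ^ r \<le> p" and M: "M \<subseteq> Fp p" "card M \<ge> 1" and J: "Fp_interval p N J"
      and N: "1 \<le> N" "real N \<le> real p powr (1 - 1 / real r)"
    define \<theta> where "\<theta> = 7 / (24 * real r)"
    define m where "m = real (card M)"
    define K where "K = sup_norm_on M \<alpha>"
    have finM: "finite M" using M finite_subset finite_Fp by blast
    have p1: "1 < p" using p(1) prime_gt_1_nat by blast
    have K: "norm (\<alpha> x) \<le> K" if "x \<in> M" for x
      unfolding K_def sup_norm_on_def using finM that by (intro Max_ge) auto
    have "K \<ge> 0"
    proof -
      obtain x where "x \<in> M" using M(2) by (metis card.empty equals0I not_one_le_zero)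
      from K[OF this] show ?thesis by (rule order.trans[OF norm_ge_zero])
    qed
    have \<theta>: "0 \<le> \<theta>" "\<theta> \<le> 1 / (2 * real r)"
      using assms(1) by (auto simp: \<theta>_def field_simps)
    have harm: "(harm p :: real) ^ 2 \<le> E * real p powr \<epsilon>"
    proof -
      have "harm p \<le> 1 + ln (real p)" using p1 by (intro harm_le_1_plus_ln) auto
      also have "\<dots> \<le> real p powr (\<epsilon> / 2) + real p powr (\<epsilon> / 2) / (\<epsilon> / 2)"
        using p1 \<open>\<epsilon> > 0\<close> by (intro add_mono ge_one_powr_ge_zero ln_powr_bound) auto
      also have "\<dots> = (1 + 2 / \<epsilon>) * real p powr (\<epsilon> / 2)" by (simp add: field_simps)
      finally have "(harm p :: real) ^ 2 \<le> ((1 + 2 / \<epsilon>) * real p powr (\<epsilon> / 2)) ^ 2"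
        by (intro power_mono harm_nonneg)
      also have "\<dots> = E * (real p powr (\<epsilon> / 2)) ^ 2" by (simp add: E_def power_mult_distrib)
      also have "(real p powr (\<epsilon> / 2)) ^ 2 = real p powr \<epsilon>"
        by (simp add: power2_eq_square flip: powr_add)
      finally show ?thesis .
    qed
    have "norm (\<Sum>m\<in>M. \<Sum>n\<in>J. \<alpha> m * kloosterman p m n) \<le>
       288 * moment_const r * K * m * real p * harm p ^ 2 *
         ((1 + (real N ^ 2 * real p powr (1 / real r - 1)) powr \<theta>) / m powr \<theta>)"
      unfolding m_def by (rule interval_kloosterman_bound[OF p assms(1) M J N K \<theta>])
    also have "\<dots> \<le> 288 * moment_const r * K * m * real p * (E * real p powr \<epsilon>) *
         ((1 + (real N ^ 2 * real p powr (1 / real r - 1)) powr \<theta>) / m powr \<theta>)"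
      using harm mc \<open>K \<ge> 0\<close> by (intro mult_right_mono mult_left_mono) (auto simp: m_def)
    also have "\<dots> = C * K * m * (real p * real p powr \<epsilon>) *
         ((1 + (real N ^ 2 * real p powr (1 / real r - 1)) powr \<theta>) / m powr \<theta>)"
      by (simp add: C_def mult_ac)
    also have "real p * real p powr \<epsilon> = real p powr (1 / 2 + \<epsilon>) * real p powr (1 / 2)"
    proof -
      have "real p * real p powr \<epsilon> = real p powr (1 + \<epsilon>)"
        using p1 by (simp add: powr_add)
      also have "1 + \<epsilon> = (1 / 2 + \<epsilon>) + 1 / 2" by simp
      finally show ?thesis by (simp only: powr_add)
    qed
    also have "(real N ^ 2 * real p powr (1 / real r - 1)) powr \<theta> =
               real N powr (7 / (12 * real r)) * real p powr (- (7 * (real r - 1) / (24 * (real r)\<^sup>2)))"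
    proof -
      have "(real N ^ 2) powr \<theta> = real N powr (2 * \<theta>)"
        using N by (simp add: powr_powr flip: powr_numeral)
      moreover have "2 * \<theta> = 7 / (12 * real r)" by (simp add: \<theta>_def)
      moreover have "(1 / real r - 1) * \<theta> = - (7 * (real r - 1) / (24 * (real r)\<^sup>2))"
        using assms(1) by (simp add: \<theta>_def field_simps power2_eq_square)
      ultimately show ?thesis by (simp only: powr_mult powr_powr)
    qed
    also have "C * K * m * (real p powr (1 / 2 + \<epsilon>) * real p powr (1 / 2)) *
        ((1 + real N powr (7 / (12 * real r)) * real p powr (- (7 * (real r - 1) / (24 * (real r)\<^sup>2)))) / m powr \<theta>) =
      C * K * m * real N * real p powr (1 / 2 + \<epsilon>) *
        (real p powr (1 / 2) / (m powr \<theta> * real N) +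
         real p powr (1 / 2 - 7 * (real r - 1) / (24 * (real r)\<^sup>2)) / (m powr \<theta> * real N powr (1 - 7 / (12 * real r))))"
    proof -
      \<comment> \<open>Here \<open>n = N\<close>, \<open>g = N powr (2 * \<theta>)\<close>,
        \<open>t = m powr \<theta>\<close>, \<open>a = p powr (1 / 2)\<close>,
        \<open>c = p powr (1 / 2 + \<epsilon>)\<close>, and \<open>b\<close> is the negative power
        of \<open>p\<close>. Powers are kept opaque so that only field arithmetic remains.\<close>
      have alg: "X * (c * a) * ((1 + g * b) / t) = X * n * c * (a / (t * n) + (a * b) / (t * (n / g)))"
        if "n > 0" "g > 0" "t > 0" for X n c a b t g :: real
        using that by (simp add: field_simps)
      have "real N powr (1 - 7 / (12 * real r)) = real N / real N powr (7 / (12 * real r))"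
        using N by (simp add: powr_diff)
      moreover have "real p powr (1 / 2 - 7 * (real r - 1) / (24 * (real r)\<^sup>2)) =
          real p powr (1 / 2) * real p powr (- (7 * (real r - 1) / (24 * (real r)\<^sup>2)))"
        by (simp flip: powr_add)
      moreover have "real N > 0" "real N powr (7 / (12 * real r)) > 0" "m powr \<theta> > 0"
        using M N by (simp_all add: m_def)
      note alg[OF this]
      ultimately show ?thesis by (simp only:)
    qed
    finally show "cmod (\<Sum>m\<in>M. \<Sum>n\<in>J. \<alpha> m * kloosterman p m n)
         \<le> C * sup_norm_on M \<alpha> * real (card M) * real N * real p powr (1/2 + \<epsilon>) *
            (real p powr (1/2) / (real (card M) powr (7 / (24 * real r)) * real N)
             + real p powr (1/2 - 7 * (real r - 1) / (24 * (real r)\<^sup>2))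
               / (real (card M) powr (7 / (24 * real r))
                  * real N powr (1 - 7 / (12 * real r))))"
      by (simp only: m_def K_def \<theta>_def)
  qed
qed

end
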